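(* Let $X$ and $Y$ be path connected Polish spaces, let $f:(X, x) \rightarrow (Y, y)$ be a continuous function of pointed spaces, and let $\mathcal{P}$ be a nice pointclass. The following hold: (1) If $H\leq \pi_1(Y, y)$ is $\mathcal{P}$ then $f_*^{-1}(H)\leq \pi_1(X, x)$ is $\mathcal{P}$. (2) If $G\leq \pi_1(X, x)$ is $\mathcal{P}$ then $f_*(G)\leq \pi_1(Y, y)$ is $\mathcal{P}$. (3) The subgroups $1$ and $\pi_1(X, x)$ are analytic in $\pi_1(X, x)$. (4) If the subgroups $G_n \leq \pi_1(X, x)$, $n\in\omega$, are $\mathcal{P}$ then so are $\bigcap_{n\in \omega} G_n$ and $\langle \bigcup_{n\in \omega} G_n \rangle$. (5) Countable subgroups of $\pi_1(X, x)$ are analytic. (6) If $G\leq \pi_1(X, x)$ is $\mathcal{P}$ then so is the normal closure $\langle \langle G \rangle\rangle$. (7) If $G\leq \pi_1(X,x)$ is $\mathcal{P}$ then so is any conjugate of $G$. (8) If $w(x_0, \ldots, x_k)$ is a reduced word in the free group $F(x_0, \ldots, x_k)$ and the subgroups $G_0, \ldots, G_k \leq \pi_1(X, x)$ are $\mathcal{P}$, then so is the subgroup $\langle \{w(g_0, g_1, \ldots, g_k) : g_i \in G_i\}\rangle$. (9) If $G, H \leq \pi_1(X, x)$ are $\mathcal{P}$ then so is the subgroup $[G, H]$. (10) If $G\leq \pi_1(X, x)$ is $\mathcal{P}$ then each countable index term $G^{(\alpha)}$ of the derived series of $G$ and each term $G_n$ of the lower central series of $G$ is $\mathcal{P}$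.
   Context: A space is Polish if it is completely metrizable and separable. For a path connected metric space $X$ and $x\in X$, $L_x$ is the set of loops $[0,1]\to X$ based at $x$ with the sup metric; it is Polish when $X$ is. For $G\leq \pi_1(X,x)$, $\bigcup G\subseteq L_x$ is the set of all loops whose homotopy class lies in $G$; "$G$ is $\mathcal{P}$" means that $\bigcup G$ belongs to $\mathcal{P}$ in $L_x$. A pointclass on Polish spaces assigns to each Polish space a collection of its subsets (of a given topological description). It is nice if it contains the closed sets and is closed under continuous images and preimages (between Polish spaces), countable intersections and finite unions. A subset of a Polish space is analytic if it is a continuous image of a Polish space; $G$ is analytic if $\bigcup G$ is analytic in $L_x$. For a group $G$: $G^{(0)}=G$, $G^{(\alpha+1)}=[G^{(\alpha)},G^{(\alpha)}]$, $G^{(\beta)}=\bigcap_{\alpha<\beta}G^{(\alpha)}$ for limit ordinals $\beta$; $G_0=G$, $G_{n+1}=[G,G_n]$. *)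

theory Defs
  imports "HOL-Analysis.Analysis" "HOL-Algebra.Generated_Groups"
begin

section \<open>Polish spaces and pointclasses\<close>

definition Polish :: "'a topology \<Rightarrow> bool" where
  "Polish T \<longleftrightarrow> completely_metrizable_space T \<and> separable_space T"

text \<open>
  A pointclass assigns a family of subsets to every Polish space. HOL cannot quantify over all types
  inside a formula, so pointclasses are given on the Polish topologies whose underlying set is
  a set of reals. Since a Polish space has at most continuum many points, every Polish space is
  homeomorphic to one of these. A nice pointclass is closed under continuous preimages,
  hence invariant under homeomorphisms, so it extends to all Polish spaces in exactly one way;
  this extension is \<open>in_pointclass\<close>. The values of a pointclass at topologies that are not Polish
  are irrelevant.
\<close>

type_synonym pointclass = "real topology \<Rightarrow> real set set"

definition nice_pointclass :: "pointclass \<Rightarrow> bool" where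
  "nice_pointclass \<P> \<longleftrightarrow>
     (\<forall>S. Polish S \<longrightarrow> \<P> S \<subseteq> Pow (topspace S)) \<and>
     (\<forall>S C. Polish S \<and> closedin S C \<longrightarrow> C \<in> \<P> S) \<and>
     (\<forall>S T g A. Polish S \<and> Polish T \<and> continuous_map S T g \<and> A \<in> \<P> S \<longrightarrow> g ` A \<in> \<P> T) \<and>
     (\<forall>S T g B. Polish S \<and> Polish T \<and> continuous_map S T g \<and> B \<in> \<P> T \<longrightarrow>
        {s \<in> topspace S. g s \<in> B} \<in> \<P> S) \<and>
     (\<forall>S (A :: nat \<Rightarrow> real set). Polish S \<and> (\<forall>n. A n \<in> \<P> S) \<longrightarrow> (\<Inter>n. A n) \<in> \<P> S) \<and>
     (\<forall>S A B. Polish S \<and> A \<in> \<P> S \<and> B \<in> \<P> S \<longrightarrow> A \<union> B \<in> \<P> S)"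

definition in_pointclass :: "pointclass \<Rightarrow> 'a topology \<Rightarrow> 'a set \<Rightarrow> bool" where
  "in_pointclass \<P> T A \<longleftrightarrow> A \<subseteq> topspace T \<and>
     (\<exists>(S :: real topology) h. Polish S \<and> homeomorphic_map T S h \<and> h ` A \<in> \<P> S)"

text \<open>As above, topologies on sets of reals represent all Polish spaces.\<close>

definition analytic_in :: "'a topology \<Rightarrow> 'a set \<Rightarrow> bool" where
  "analytic_in T A \<longleftrightarrow>
     (\<exists>(S :: real topology) g. Polish S \<and> continuous_map S T g \<and> A = g ` topspace S)"


section \<open>Loop spaces and the fundamental group\<close>

text \<open>
  Loops are functions on \<^term>\<open>{0..1::real}\<close>; as elements of the type \<^typ>\<open>real \<Rightarrow> 'a\<close> they
  are made unique by being undefined outside the unit interval.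
\<close>

definition loops :: "'a::topological_space set \<Rightarrow> 'a \<Rightarrow> (real \<Rightarrow> 'a) set" where
  "loops X x = {p \<in> extensional {0..1}.
     path p \<and> path_image p \<subseteq> X \<and> pathstart p = x \<and> pathfinish p = x}"

text \<open>The metric of \<^const>\<open>cfunspace\<close> is the sup metric.\<close>

definition loop_space :: "'a::metric_space set \<Rightarrow> 'a \<Rightarrow> (real \<Rightarrow> 'a) topology" where
  "loop_space X x =
     mtopology_of (submetric (cfunspace (top_of_set {0..1}) euclidean_metric) (loops X x))"

lemma topspace_loop_space [simp]: "topspace (loop_space X x) = loops X x"
proof -
  have "loops X x \<subseteq> mspace (cfunspace (top_of_set {0..1}) euclidean_metric)"
    by (subst compactin_mspace_cfunspace) (auto simp: loops_def path_def compactin_subtopology)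
  then show ?thesis
    by (auto simp: loop_space_def)
qed

text \<open>The homotopy class of a path \<open>p\<close> that need not be undefined outside the unit interval.\<close>

definition loop_class :: "'a::topological_space set \<Rightarrow> 'a \<Rightarrow> (real \<Rightarrow> 'a) \<Rightarrow> (real \<Rightarrow> 'a) set" where
  "loop_class X x p = {q \<in> loops X x. homotopic_paths X p q}"

definition fundamental_group :: "'a::topological_space set \<Rightarrow> 'a \<Rightarrow> (real \<Rightarrow> 'a) set monoid" where
  "fundamental_group X x =
     \<lparr>carrier = loop_class X x ` loops X x,
      mult = (\<lambda>a b. \<Union>p\<in>a. \<Union>q\<in>b. loop_class X x (p +++ q)),
      one = loop_class X x (\<lambda>_. x)\<rparr>"

lemma loop_class_nonempty:
  assumes "path p" "path_image p \<subseteq> X" "pathstart p = x" "pathfinish p = x"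
  shows "restrict p {0..1} \<in> loop_class X x p"
proof -
  have *: "homotopic_paths X p (restrict p {0..1})"
    using assms by (intro homotopic_paths_eq) auto
  have "pathstart (restrict p {0..1}) = x" "pathfinish (restrict p {0..1}) = x"
    using assms by (auto simp: pathstart_def pathfinish_def)
  then show ?thesis
    using * homotopic_paths_imp_path[OF *] homotopic_paths_imp_subset[OF *]
    by (simp add: loop_class_def loops_def)
qed

lemma loop_class_eq:
  assumes "homotopic_paths X p q"
  shows "loop_class X x p = loop_class X x q"
  using assms homotopic_paths_trans homotopic_paths_sym unfolding loop_class_def by blast

lemma loop_class_mult:
  assumes "path p" "path_image p \<subseteq> X" "pathstart p = x" "pathfinish p = x"
    and "path q" "path_image q \<subseteq> X" "pathstart q = x" "pathfinish q = x"
  shows "loop_class X x p \<otimes>\<^bsub>fundamental_group X x\<^esub> loop_class X x q = loop_class X x (p +++ q)"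
proof -
  have "loop_class X x (p' +++ q') = loop_class X x (p +++ q)"
    if "p' \<in> loop_class X x p" "q' \<in> loop_class X x q" for p' q'
  proof -
    have "homotopic_paths X p p'" "homotopic_paths X q q'"
      using that by (simp_all add: loop_class_def)
    then have "homotopic_paths X (p +++ q) (p' +++ q')"
      using assms by (intro homotopic_paths_join) simp_all
    from loop_class_eq[OF this] show ?thesis ..
  qed
  then have "loop_class X x p \<otimes>\<^bsub>fundamental_group X x\<^esub> loop_class X x q =
      (\<Union>p'\<in>loop_class X x p. \<Union>q'\<in>loop_class X x q. loop_class X x (p +++ q))"
    by (simp add: fundamental_group_def)
  then show ?thesis
    using loop_class_nonempty[OF assms(1-4)] loop_class_nonempty[OF assms(5-8)] by auto
qed

lemma loop_class_in_carrier:
  assumes "path p" "path_image p \<subseteq> X" "pathstart p = x" "pathfinish p = x"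
  shows "loop_class X x p \<in> carrier (fundamental_group X x)"
proof -
  have "restrict p {0..1} \<in> loops X x" "homotopic_paths X p (restrict p {0..1})"
    using loop_class_nonempty[OF assms] by (simp_all add: loop_class_def)
  then show ?thesis
    using loop_class_eq unfolding fundamental_group_def partial_object.simps by blast
qed

lemma homotopic_const_join:
  assumes "path p" "path_image p \<subseteq> X" "pathstart p = x"
  shows "homotopic_paths X ((\<lambda>_. x) +++ p) p"
proof -
  have "continuous_on {0..1} (\<lambda>t::real. max 0 (2 * t - 1))"
    by (intro continuous_intros)
  moreover have "((\<lambda>_. x) +++ p) t = p (max 0 (2 * t - 1))" for t
    using assms
    by (cases "2 * t = 1") (auto simp: joinpaths_def pathstart_def max_def)
  ultimately have "homotopic_paths X p ((\<lambda>_. x) +++ p)"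
    using assms
    by (intro homotopic_paths_reparametrize[where f = "\<lambda>t. max 0 (2 * t - 1)"]) auto
  then show ?thesis
    by (rule homotopic_paths_sym)
qed

lemma homotopic_reversepath_join:
  assumes "path p" "path_image p \<subseteq> X" "pathfinish p = x"
  shows "homotopic_paths X (reversepath p +++ p) (\<lambda>_. x)"
proof -
  define \<phi> where "\<phi> = (\<lambda>t::real. \<bar>2 * t - 1\<bar>)"
  have p: "continuous_on {0..1} p"
    using assms by (simp add: path_def)
  have eq: "(reversepath p +++ p) t = p (\<phi> t)" if "t \<in> {0..1}" for t
    using that
    by (cases "2 * t = 1") (auto simp: joinpaths_def reversepath_def \<phi>_def abs_if)
  have "continuous_on ({0..1} \<times> {0..1}) (\<lambda>z. p (max (fst z) (\<phi> (snd z))))"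
    unfolding \<phi>_def by (intro continuous_on_compose2[OF p] continuous_intros) auto
  moreover have "max s (\<phi> t) \<in> {0..1}" if "s \<in> {0..1}" "t \<in> {0..1}" for s t
    using that by (auto simp: \<phi>_def)
  moreover have "p (max 1 (\<phi> t)) = x" if "t \<in> {0..1}" for t
  proof -
    have "max 1 (\<phi> t) = 1"
      using that by (auto simp: \<phi>_def max_def)
    then show ?thesis
      using assms by (simp add: pathfinish_def)
  qed
  ultimately show ?thesis
    unfolding homotopic_paths using assms(2,3) eq
    by (intro exI[of _ "\<lambda>z. p (max (fst z) (\<phi> (snd z)))"])
       (auto simp: path_image_def pathstart_def pathfinish_def joinpaths_def reversepath_def
          \<phi>_def image_subset_iff Pi_iff max_def)
qed

lemma group_fundamental_group:
  assumes "x \<in> X"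
  shows "group (fundamental_group X x)"
proof (rule groupI)
  let ?\<pi> = "fundamental_group X x"
  have const: "path (\<lambda>_::real. x)" "path_image (\<lambda>_::real. x) \<subseteq> X"
    "pathstart (\<lambda>_::real. x) = x" "pathfinish (\<lambda>_::real. x) = x"
    using assms by (auto simp: path_def path_image_def pathstart_def pathfinish_def)
  have rep: "\<exists>p. a = loop_class X x p \<and> path p \<and> path_image p \<subseteq> X \<and> pathstart p = x \<and> pathfinish p = x"
    if "a \<in> carrier ?\<pi>" for a
    using that by (auto simp: fundamental_group_def loops_def)
  have one: "\<one>\<^bsub>?\<pi>\<^esub> = loop_class X x (\<lambda>_. x)"
    by (simp add: fundamental_group_def)
  show "\<one>\<^bsub>?\<pi>\<^esub> \<in> carrier ?\<pi>"
    unfolding one by (intro loop_class_in_carrier const)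
  show "a \<otimes>\<^bsub>?\<pi>\<^esub> b \<in> carrier ?\<pi>" if "a \<in> carrier ?\<pi>" "b \<in> carrier ?\<pi>" for a b
    using rep[OF that(1)] rep[OF that(2)]
    by (force simp: loop_class_mult path_image_join intro!: loop_class_in_carrier)
  show "a \<otimes>\<^bsub>?\<pi>\<^esub> b \<otimes>\<^bsub>?\<pi>\<^esub> c = a \<otimes>\<^bsub>?\<pi>\<^esub> (b \<otimes>\<^bsub>?\<pi>\<^esub> c)"
    if "a \<in> carrier ?\<pi>" "b \<in> carrier ?\<pi>" "c \<in> carrier ?\<pi>" for a b c
  proof -
    obtain p q s where "a = loop_class X x p" "path p" "path_image p \<subseteq> X" "pathstart p = x" "pathfinish p = x"
      "b = loop_class X x q" "path q" "path_image q \<subseteq> X" "pathstart q = x" "pathfinish q = x"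
      "c = loop_class X x s" "path s" "path_image s \<subseteq> X" "pathstart s = x" "pathfinish s = x"
      using rep[OF \<open>a \<in> carrier ?\<pi>\<close>] rep[OF \<open>b \<in> carrier ?\<pi>\<close>] rep[OF \<open>c \<in> carrier ?\<pi>\<close>] by blast
    then show ?thesis
      using loop_class_eq[OF homotopic_paths_assoc[of p X q s]]
      by (simp add: loop_class_mult subset_path_image_join del: path_image_join)
  qed
  show "\<one>\<^bsub>?\<pi>\<^esub> \<otimes>\<^bsub>?\<pi>\<^esub> a = a" if "a \<in> carrier ?\<pi>" for a
  proof -
    obtain p where p: "a = loop_class X x p" "path p" "path_image p \<subseteq> X" "pathstart p = x" "pathfinish p = x"
      using rep[OF \<open>a \<in> carrier ?\<pi>\<close>] by blast
    then have "\<one>\<^bsub>?\<pi>\<^esub> \<otimes>\<^bsub>?\<pi>\<^esub> a = loop_class X x ((\<lambda>_. x) +++ p)"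
      unfolding one p(1) by (intro loop_class_mult const) auto
    also have "\<dots> = a"
      unfolding p(1) by (intro loop_class_eq homotopic_const_join p)
    finally show ?thesis .
  qed
  show "\<exists>b\<in>carrier ?\<pi>. b \<otimes>\<^bsub>?\<pi>\<^esub> a = \<one>\<^bsub>?\<pi>\<^esub>" if "a \<in> carrier ?\<pi>" for a
  proof -
    obtain p where p: "a = loop_class X x p" "path p" "path_image p \<subseteq> X" "pathstart p = x" "pathfinish p = x"
      using rep[OF \<open>a \<in> carrier ?\<pi>\<close>] by blast
    then have "loop_class X x (reversepath p) \<otimes>\<^bsub>?\<pi>\<^esub> a = \<one>\<^bsub>?\<pi>\<^esub>"
      by (auto simp: one loop_class_mult intro!: loop_class_eq homotopic_reversepath_join)
    moreover have "loop_class X x (reversepath p) \<in> carrier ?\<pi>"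
      using p by (intro loop_class_in_carrier) auto
    ultimately show ?thesis ..
  qed
qed

definition induced_map ::
  "'b::topological_space set \<Rightarrow> 'b \<Rightarrow> ('a \<Rightarrow> 'b) \<Rightarrow> (real \<Rightarrow> 'a) set \<Rightarrow> (real \<Rightarrow> 'b) set" where
  "induced_map Y y f a = (\<Union>p\<in>a. loop_class Y y (f \<circ> p))"

definition pointclass_subgroup ::
  "pointclass \<Rightarrow> 'a::metric_space set \<Rightarrow> 'a \<Rightarrow> (real \<Rightarrow> 'a) set set \<Rightarrow> bool" where
  "pointclass_subgroup \<P> X x G \<longleftrightarrow>
     subgroup G (fundamental_group X x) \<and> in_pointclass \<P> (loop_space X x) (\<Union>G)"

definition analytic_subgroup :: "'a::metric_space set \<Rightarrow> 'a \<Rightarrow> (real \<Rightarrow> 'a) set set \<Rightarrow> bool" where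
  "analytic_subgroup X x G \<longleftrightarrow>
     subgroup G (fundamental_group X x) \<and> analytic_in (loop_space X x) (\<Union>G)"


section \<open>Group-theoretic constructions\<close>

definition normal_closure :: "('g, 'm) monoid_scheme \<Rightarrow> 'g set \<Rightarrow> 'g set" where
  "normal_closure \<Gamma> A = \<Inter>{N. N \<lhd> \<Gamma> \<and> A \<subseteq> N}"

definition conjugate_set :: "('g, 'm) monoid_scheme \<Rightarrow> 'g \<Rightarrow> 'g set \<Rightarrow> 'g set" where
  "conjugate_set \<Gamma> c A = (\<lambda>a. c \<otimes>\<^bsub>\<Gamma>\<^esub> a \<otimes>\<^bsub>\<Gamma>\<^esub> inv\<^bsub>\<Gamma>\<^esub> c) ` A"

text \<open>The two-argument version of \<^const>\<open>derived\<close>.\<close>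

definition commutator_subgroup :: "('g, 'm) monoid_scheme \<Rightarrow> 'g set \<Rightarrow> 'g set \<Rightarrow> 'g set" where
  "commutator_subgroup \<Gamma> A B =
     generate \<Gamma> {a \<otimes>\<^bsub>\<Gamma>\<^esub> b \<otimes>\<^bsub>\<Gamma>\<^esub> inv\<^bsub>\<Gamma>\<^esub> a \<otimes>\<^bsub>\<Gamma>\<^esub> inv\<^bsub>\<Gamma>\<^esub> b | a b. a \<in> A \<and> b \<in> B}"

lemma derived_eq_commutator_subgroup: "derived \<Gamma> A = commutator_subgroup \<Gamma> A A"
  unfolding derived_def commutator_subgroup_def by (rule arg_cong[where f = "generate \<Gamma>"]) blast

text \<open>
  The letter \<open>(i, True)\<close> stands for the generator \<open>x\<^sub>i\<close> and \<open>(i, False)\<close> for its inverse. The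
  elements of the free group on \<open>x\<^sub>0, \<dots>, x\<^sub>k\<close> are the reduced words over the letters with index
  at most \<open>k\<close>.
\<close>

type_synonym word = "(nat \<times> bool) list"

definition reduced_word :: "nat \<Rightarrow> word \<Rightarrow> bool" where
  "reduced_word k w \<longleftrightarrow> fst ` set w \<subseteq> {..k} \<and>
     successively (\<lambda>(i, b) (j, c). \<not> (i = j \<and> b \<noteq> c)) w"

definition eval_word :: "('g, 'm) monoid_scheme \<Rightarrow> (nat \<Rightarrow> 'g) \<Rightarrow> word \<Rightarrow> 'g" where
  "eval_word \<Gamma> g w =
     foldr (\<lambda>(i, b) u. (if b then g i else inv\<^bsub>\<Gamma>\<^esub> g i) \<otimes>\<^bsub>\<Gamma>\<^esub> u) w \<one>\<^bsub>\<Gamma>\<^esub>"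

primrec lower_central :: "('g, 'm) monoid_scheme \<Rightarrow> 'g set \<Rightarrow> nat \<Rightarrow> 'g set" where
  "lower_central \<Gamma> G 0 = G"
| "lower_central \<Gamma> G (Suc n) = commutator_subgroup \<Gamma> G (lower_central \<Gamma> G n)"

text \<open>
  In a well-order \<open>r\<close>, an element \<open>\<alpha>\<close> of the field represents the ordinal that is the order type of
  the set \<^term>\<open>underS r \<alpha>\<close> of its strict predecessors. The countable ordinals are exactly the ordinals
  represented by elements of well-orders on sets of natural numbers.
\<close>

definition is_succ_of :: "'o rel \<Rightarrow> 'o \<Rightarrow> 'o \<Rightarrow> bool" where
  "is_succ_of r \<alpha> \<beta> \<longleftrightarrow> \<beta> \<in> underS r \<alpha> \<and> (\<forall>\<gamma>\<in>underS r \<alpha>. (\<gamma>, \<beta>) \<in> r)"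

definition derived_series ::
  "('g, 'm) monoid_scheme \<Rightarrow> 'g set \<Rightarrow> 'o rel \<Rightarrow> 'o \<Rightarrow> 'g set" where
  "derived_series \<Gamma> G r = wfrec (r - Id) (\<lambda>D \<alpha>.
     if underS r \<alpha> = {} then G
     else if \<exists>\<beta>. is_succ_of r \<alpha> \<beta> then derived \<Gamma> (D (THE \<beta>. is_succ_of r \<alpha> \<beta>))
     else \<Inter>\<beta>\<in>underS r \<alpha>. D \<beta>)"

lemma is_succ_of_unique:
  assumes "Well_order r" "is_succ_of r \<alpha> \<beta>" "is_succ_of r \<alpha> \<gamma>"
  shows "\<gamma> = \<beta>"
  using assms wo_rel.ANTISYM[of r]
  by (auto simp: is_succ_of_def wo_rel_def antisym_def)

lemma derived_series_unfold:
  fixes r :: "'o rel" and G :: "'g set"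
  assumes "Well_order r"
  shows "derived_series \<Gamma> G r \<alpha> =
    (if underS r \<alpha> = {} then G
     else if \<exists>\<beta>. is_succ_of r \<alpha> \<beta>
       then derived \<Gamma> (derived_series \<Gamma> G r (THE \<beta>. is_succ_of r \<alpha> \<beta>))
     else \<Inter>\<beta>\<in>underS r \<alpha>. derived_series \<Gamma> G r \<beta>)"
proof -
  have the: "(THE \<beta>. is_succ_of r \<alpha> \<beta>) \<in> underS r \<alpha>" if "\<exists>\<beta>. is_succ_of r \<alpha> \<beta>" for \<alpha>
  proof -
    from that obtain \<beta> where \<beta>: "is_succ_of r \<alpha> \<beta>" ..
    then have "(THE \<beta>. is_succ_of r \<alpha> \<beta>) = \<beta>"
      using is_succ_of_unique[OF assms] by (intro the_equality) auto
    with \<beta> show ?thesis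
      by (simp add: is_succ_of_def)
  qed
  define F where "F = (\<lambda>D \<alpha>.
     if underS r \<alpha> = {} then G
     else if \<exists>\<beta>. is_succ_of r \<alpha> \<beta> then derived \<Gamma> (D (THE \<beta>. is_succ_of r \<alpha> \<beta>))
     else \<Inter>\<beta>\<in>underS r \<alpha>. D \<beta>)"
  have wo: "wo_rel r"
    using assms by (simp add: wo_rel_def)
  have "wo_rel.adm_wo r F"
    unfolding wo_rel.adm_wo_def[OF wo]
  proof (intro allI impI)
    fix D E :: "'o \<Rightarrow> 'g set" and \<alpha>
    assume eq: "\<forall>\<beta>\<in>underS r \<alpha>. D \<beta> = E \<beta>"
    then have "D (THE \<beta>. is_succ_of r \<alpha> \<beta>) = E (THE \<beta>. is_succ_of r \<alpha> \<beta>)"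
      if "\<exists>\<beta>. is_succ_of r \<alpha> \<beta>"
      using the[OF that] by blast
    with eq show "F D \<alpha> = F E \<alpha>"
      unfolding F_def by (intro if_cong refl) simp_all
  qed
  then have "wo_rel.worec r F = F (wo_rel.worec r F)"
    by (rule wo_rel.worec_fixpoint[OF wo])
  moreover have "derived_series \<Gamma> G r = wo_rel.worec r F"
    by (simp add: derived_series_def wo_rel.worec_def[OF wo] F_def)
  ultimately have "derived_series \<Gamma> G r \<alpha> = F (derived_series \<Gamma> G r) \<alpha>"
    by metis
  then show ?thesis
    by (simp only: F_def)
qed

lemma derived_series_zero:
  assumes "Well_order r" "underS r \<alpha> = {}"
  shows "derived_series \<Gamma> G r \<alpha> = G"
  using assms by (simp add: derived_series_unfold[of r])

lemma derived_series_succ: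
  assumes "Well_order r" "is_succ_of r \<alpha> \<beta>"
  shows "derived_series \<Gamma> G r \<alpha> = derived \<Gamma> (derived_series \<Gamma> G r \<beta>)"
proof -
  have "(THE \<beta>. is_succ_of r \<alpha> \<beta>) = \<beta>"
    using assms is_succ_of_unique by (intro the_equality) auto
  moreover have "underS r \<alpha> \<noteq> {}" "\<exists>\<beta>. is_succ_of r \<alpha> \<beta>"
    using assms by (auto simp: is_succ_of_def)
  ultimately show ?thesis
    using assms(1) by (simp add: derived_series_unfold[of r \<Gamma> G \<alpha>])
qed

lemma derived_series_limit:
  assumes "Well_order r" "underS r \<alpha> \<noteq> {}" "\<nexists>\<beta>. is_succ_of r \<alpha> \<beta>"
  shows "derived_series \<Gamma> G r \<alpha> = (\<Inter>\<beta>\<in>underS r \<alpha>. derived_series \<Gamma> G r \<beta>)"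
  using assms by (subst derived_series_unfold) auto

end

theory Submission
  imports Defs
begin

text \<open>
  For compact \<open>K\<close> and Polish \<open>X\<close> the space \<open>C(K, X)\<close> with the topology of uniform convergence is Polish;
  hence so are the loop space \<open>L\<close> and the space \<open>H\<close> of all based homotopies of loops, and the two
  end slices \<open>\<sigma>\<^sub>0, \<sigma>\<^sub>1 : H \<rightarrow> L\<close> are continuous. The set of loops homotopic to a member of \<open>A\<close> is
  \<open>\<sigma>\<^sub>1 (\<sigma>\<^sub>0\<^sup>-\<^sup>1 A)\<close>, so saturating under homotopy stays within a nice pointclass. Concatenation and reversal
  of loops are continuous, so word maps are continuous on \<open>L\<^sup>k\<close>, and the values of a word on sets of
  classes belonging to the pointclass again form such a set. Generated subgroups are countable
  unions of iterated products, and a nice pointclass is closed under countable unions. Commutators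
  and conjugates are values of words, which gives all the closure properties.
\<close>

section \<open>Polish spaces\<close>

text \<open>\<open>Polish\<close> asks only that some compatible metric be complete, while the loop
  space is built from the given metric of the ambient type, which need not be complete on
  \<open>X\<close>. Compactness of the parameter set removes this obstacle: uniform convergence on
  it does not depend on which compatible metric of the target is used. A second obstacle is that the
  group operations are defined on classes, where no topology is at hand; they are therefore carried
  out on representing loops, and saturation restores whole classes afterwards. The analyticity
  claims are not routed through a pointclass, since that would first require the closure properties
  of the analytic sets. Instead a Polish space, made of homotopies or of loops, is exhibited
  together with a continuous map onto the union of the subgroup.\<close>

lemma Polish_imp_Hausdorff: "Polish T \<Longrightarrow> Hausdorff_space T"
  by (simp add: Polish_def completely_metrizable_imp_metrizable_space metrizable_imp_Hausdorff_space)

text \<open>Separability need not pass to subspaces, second countability does; this is how closed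
  subspaces of Polish spaces are seen to be Polish. The countable base also serves to code points by
  sets of naturals.\<close>

lemma metrizable_separable_imp_second_countable:
  assumes "metrizable_space T" "separable_space T"
  shows "second_countable T"
proof -
  obtain M d where Md: "Metric_space M d" and T: "T = Metric_space.mtopology M d"
    using assms(1) by (auto simp: metrizable_space_def)
  interpret Metric_space M d by fact
  obtain D where D: "countable D" "D \<subseteq> M" "mtopology closure_of D = M"
    using assms(2) by (auto simp: separable_space_def T)
  define \<B> where "\<B> = (\<lambda>(a, n::nat). mball a (inverse (Suc n))) ` (D \<times> UNIV)"
  have "\<exists>V\<in>\<B>. z \<in> V \<and> V \<subseteq> U" if U: "openin mtopology U" "z \<in> U" for U z
  proof -
    obtain r where r: "r > 0" "mball z r \<subseteq> U"
      using U by (auto simp: openin_mtopology)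
    have zM: "z \<in> M"
      using U openin_mtopology by auto
    obtain n where n: "inverse (real (Suc n)) < r / 2"
      using reals_Archimedean[of "r/2"] r by auto
    obtain a where a: "a \<in> D" "d a z < inverse (Suc n)"
    proof -
      have "z \<in> mtopology closure_of D" using D zM by simp
      then obtain a where "a \<in> D" "a \<in> mball z (inverse (Suc n))"
        unfolding metric_closure_of by (smt (verit) inverse_positive_iff_positive mem_Collect_eq of_nat_0_less_iff zero_less_Suc)
      then show thesis using that by (auto simp: commute)
    qed
    have "mball a (inverse (Suc n)) \<subseteq> mball z r"
    proof
      fix u assume "u \<in> mball a (inverse (Suc n))"
      then have u: "a \<in> M" "u \<in> M" "d a u < inverse (Suc n)" by auto
      have "d z u \<le> d z a + d a u" using u zM triangle by blast
      then have "d z u < r" using a n u commute[of a z] by linarith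
      then show "u \<in> mball z r" using u zM by auto
    qed
    moreover have "z \<in> mball a (inverse (Suc n))" using a zM D by auto
    moreover have "mball a (inverse (Suc n)) \<in> \<B>" using a by (force simp: \<B>_def)
    ultimately show ?thesis using r by blast
  qed
  moreover have "countable \<B>" using D by (auto simp: \<B>_def)
  moreover have "openin mtopology V" if "V \<in> \<B>" for V using that by (auto simp: \<B>_def)
  ultimately show ?thesis
    unfolding second_countable_def T by blast
qed

lemma Polish_imp_second_countable: "Polish T \<Longrightarrow> second_countable T"
  by (simp add: Polish_def completely_metrizable_imp_metrizable_space metrizable_separable_imp_second_countable)

lemma Polish_closedin: "Polish T \<Longrightarrow> closedin T C \<Longrightarrow> Polish (subtopology T C)"
  using Polish_imp_second_countable[of T]
  by (simp add: Polish_def completely_metrizable_space_closedin second_countable_imp_separable_space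
      second_countable_subtopology)

lemma Polish_homeomorphic: "T homeomorphic_space S \<Longrightarrow> Polish T \<longleftrightarrow> Polish S"
  unfolding Polish_def using homeomorphic_completely_metrizable_space homeomorphic_separable_space by blast

lemma Polish_discrete: "countable U \<Longrightarrow> Polish (discrete_topology U)"
  by (simp add: Polish_def completely_metrizable_space_discrete_topology separable_space_discrete_topology)

lemma Polish_prod:
  assumes "Polish S" "Polish T"
  shows "Polish (prod_topology S T)"
proof -
  obtain C D where "countable C" "C \<subseteq> topspace S" "S closure_of C = topspace S"
    "countable D" "D \<subseteq> topspace T" "T closure_of D = topspace T"
    using assms by (auto simp: Polish_def separable_space_def)
  then have "separable_space (prod_topology S T)"
    unfolding separable_space_def by (intro exI[of _ "C \<times> D"]) (auto simp: closure_of_Times)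
  with assms show ?thesis
    by (simp add: Polish_def completely_metrizable_space_prod_topology)
qed

lemma Polish_product:
  assumes "finite I" "\<And>i. i \<in> I \<Longrightarrow> Polish (T i)"
  shows "Polish (product_topology T I)"
proof -
  have "\<forall>i\<in>I. \<exists>D. countable D \<and> D \<subseteq> topspace (T i) \<and> T i closure_of D = topspace (T i)"
    using assms by (auto simp: Polish_def separable_space_def)
  then obtain D where D: "\<And>i. i \<in> I \<Longrightarrow> countable (D i)" "\<And>i. i \<in> I \<Longrightarrow> D i \<subseteq> topspace (T i)"
    "\<And>i. i \<in> I \<Longrightarrow> T i closure_of D i = topspace (T i)"
    by metis
  have "separable_space (product_topology T I)"
    unfolding separable_space_def
  proof (intro exI[of _ "PiE I D"] conjI)
    show "countable (PiE I D)"
      using assms D by (intro countable_PiE) auto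
    show "PiE I D \<subseteq> topspace (product_topology T I)"
      using D by (auto simp: PiE_mono)
    show "product_topology T I closure_of PiE I D = topspace (product_topology T I)"
      using D(3) by (auto simp: closure_of_product_topology intro!: PiE_cong)
  qed
  then show ?thesis
    using assms by (auto simp: Polish_def completely_metrizable_space_product_topology countable_finite)
qed

text \<open>
  A point of a second countable Hausdorff space is determined by the basic open sets that contain
  it, so the space injects into the power set of the natural numbers.
\<close>

lemma Polish_real_copy:
  assumes "Polish T"
  obtains S :: "real topology" and h where "Polish S" "homeomorphic_map T S h"
proof -
  obtain \<B> where \<B>: "countable \<B>" "\<And>V. V \<in> \<B> \<Longrightarrow> openin T V"
    "\<And>U z. openin T U \<Longrightarrow> z \<in> U \<Longrightarrow> \<exists>V\<in>\<B>. z \<in> V \<and> V \<subseteq> U"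
    using Polish_imp_second_countable[OF assms] by (auto simp: second_countable_def)
  define c where "c z = to_nat_on \<B> ` {V \<in> \<B>. z \<in> V}" for z
  have "inj_on c (topspace T)"
  proof (rule inj_onI, rule ccontr)
    fix u v assume uv: "u \<in> topspace T" "v \<in> topspace T" "c u = c v" "u \<noteq> v"
    have "{V \<in> \<B>. u \<in> V} = {V \<in> \<B>. v \<in> V}"
      using uv(3) inj_on_image_eq_iff[OF inj_on_to_nat_on[OF \<B>(1)], of "{V \<in> \<B>. u \<in> V}" "{V \<in> \<B>. v \<in> V}"]
      by (auto simp: c_def)
    moreover obtain U where "openin T U" "u \<in> U" "v \<notin> U"
      using Polish_imp_Hausdorff[OF assms] uv unfolding Hausdorff_space_def
      by (metis disjnt_iff)
    ultimately show False
      using \<B>(3)[of U u] by blast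
  qed
  moreover obtain e :: "nat set \<Rightarrow> real" where "inj e"
    using nat_sets_eqpoll_reals unfolding eqpoll_def bij_betw_def by blast
  ultimately have inj: "inj_on (e \<circ> c) (topspace T)"
    by (metis comp_inj_on inj_on_subset subset_UNIV)
  define h where "h = e \<circ> c"
  define g where "g = inv_into (topspace T) h"
  \<comment> \<open>The image in the reals gets the topology transported from \<open>T\<close>, not
    the subspace topology, so that \<open>h\<close> is a homeomorphism by construction.\<close>
  define S where "S = pullback_topology (h ` topspace T) g T"
  have gh: "g (h z) = z" if "z \<in> topspace T" for z
    using inj that by (simp add: g_def h_def del: o_apply)
  have S: "topspace S = h ` topspace T"
    using gh by (auto simp: S_def topspace_pullback_topology)
  have "homeomorphic_maps T S h g"
    unfolding homeomorphic_maps_def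
  proof (intro conjI ballI)
    show "continuous_map S T g"
      unfolding S_def by (metis (no_types) continuous_map_id continuous_map_pullback id_comp o_id)
    have "continuous_map T T (g \<circ> h)"
      by (rule continuous_map_eq[OF continuous_map_id]) (simp add: gh)
    then show "continuous_map T S h"
      unfolding S_def by (rule continuous_map_pullback') auto
  qed (use gh S in auto)
  then have "homeomorphic_map T S h"
    using homeomorphic_maps_map by blast
  moreover from this have "Polish S"
    using Polish_homeomorphic assms homeomorphic_map_imp_homeomorphic_space by blast
  ultimately show thesis
    using that by blast
qed


section \<open>Pointclasses\<close>

lemma in_pointclass_subset: "in_pointclass \<P> T A \<Longrightarrow> A \<subseteq> topspace T"
  by (simp add: in_pointclass_def)

lemma nice_closed: "nice_pointclass \<P> \<Longrightarrow> Polish S \<Longrightarrow> closedin S C \<Longrightarrow> C \<in> \<P> S"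
  by (simp add: nice_pointclass_def)

lemma nice_image:
  "nice_pointclass \<P> \<Longrightarrow> Polish S \<Longrightarrow> Polish T \<Longrightarrow> continuous_map S T g \<Longrightarrow> A \<in> \<P> S \<Longrightarrow> g ` A \<in> \<P> T"
  unfolding nice_pointclass_def by blast

lemma nice_preimage:
  "nice_pointclass \<P> \<Longrightarrow> Polish S \<Longrightarrow> Polish T \<Longrightarrow> continuous_map S T g \<Longrightarrow> B \<in> \<P> T \<Longrightarrow>
    {s \<in> topspace S. g s \<in> B} \<in> \<P> S"
  unfolding nice_pointclass_def by blast

lemma nice_Inter:
  "nice_pointclass \<P> \<Longrightarrow> Polish S \<Longrightarrow> (\<And>n::nat. A n \<in> \<P> S) \<Longrightarrow> (\<Inter>n. A n) \<in> \<P> S"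
  by (simp add: nice_pointclass_def)

lemma nice_Un: "nice_pointclass \<P> \<Longrightarrow> Polish S \<Longrightarrow> A \<in> \<P> S \<Longrightarrow> B \<in> \<P> S \<Longrightarrow> A \<union> B \<in> \<P> S"
  by (simp add: nice_pointclass_def)

text \<open>The existential quantifier over real copies in \<open>in_pointclass\<close> is harmless:
  the transition map between two copies is continuous, and a nice pointclass is closed under
  continuous images. Hence any one copy decides membership.\<close>

lemma in_pointclass_iff:
  assumes \<P>: "nice_pointclass \<P>" and S: "Polish S" and h: "homeomorphic_map T S h"
  shows "in_pointclass \<P> T A \<longleftrightarrow> A \<subseteq> topspace T \<and> h ` A \<in> \<P> S"
proof
  assume "in_pointclass \<P> T A"
  then obtain S' h' where A: "A \<subseteq> topspace T" and S': "Polish S'"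
    and h': "homeomorphic_map T S' h'" and A': "h' ` A \<in> \<P> S'"
    by (auto simp: in_pointclass_def)
  obtain k where k: "homeomorphic_maps T S' h' k"
    using h' homeomorphic_map_maps by blast
  have "continuous_map S' S (h \<circ> k)"
    using h k by (meson continuous_map_compose homeomorphic_imp_continuous_map homeomorphic_maps_def)
  then have "(h \<circ> k) ` (h' ` A) \<in> \<P> S"
    by (rule nice_image[OF \<P> S' S _ A'])
  moreover have "k (h' z) = z" if "z \<in> A" for z
    using k A that by (auto simp: homeomorphic_maps_def)
  then have "(h \<circ> k) ` (h' ` A) = h ` A"
    by (force simp: image_iff)
  ultimately show "A \<subseteq> topspace T \<and> h ` A \<in> \<P> S"
    using A by simp
qed (use S h in \<open>auto simp: in_pointclass_def\<close>)

text \<open>Within this locale the closure properties are carried from topologies on sets of reals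
  to Polish topologies on any type, by conjugating maps with homeomorphisms onto real
  copies.\<close>

locale nice_class =
  fixes \<P> :: pointclass
  assumes nice: "nice_pointclass \<P>"
begin

lemma closed:
  assumes "Polish T" "closedin T C"
  shows "in_pointclass \<P> T C"
proof -
  obtain S :: "real topology" and h where S: "Polish S" "homeomorphic_map T S h"
    using Polish_real_copy[OF assms(1)] .
  have "C \<subseteq> topspace T" using assms(2) closedin_subset by blast
  moreover then have "closedin S (h ` C)"
    using assms(2) S(2) homeomorphic_map_closedness by blast
  ultimately show ?thesis
    by (simp add: in_pointclass_iff[OF nice S] nice_closed[OF nice S(1)])
qed

lemma image:
  assumes "Polish S" "Polish T" "continuous_map S T g" "in_pointclass \<P> S A"
  shows "in_pointclass \<P> T (g ` A)"
proof -
  obtain S' :: "real topology" and h where S': "Polish S'" "homeomorphic_map S S' h"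
    using Polish_real_copy[OF assms(1)] .
  obtain T' :: "real topology" and k where T': "Polish T'" "homeomorphic_map T T' k"
    using Polish_real_copy[OF assms(2)] .
  obtain h' where h': "homeomorphic_maps S S' h h'"
    using S' homeomorphic_map_maps by blast
  have A: "A \<subseteq> topspace S" "h ` A \<in> \<P> S'"
    using assms(4) in_pointclass_iff[OF nice S'] by auto
  have "continuous_map S' T' (k \<circ> g \<circ> h')"
    using assms(3) h' T' by (meson continuous_map_compose homeomorphic_imp_continuous_map homeomorphic_maps_def)
  then have "(k \<circ> g \<circ> h') ` (h ` A) \<in> \<P> T'"
    by (rule nice_image[OF nice S'(1) T'(1) _ A(2)])
  moreover have "h' (h z) = z" if "z \<in> A" for z
    using h' A that by (auto simp: homeomorphic_maps_def)
  then have "(k \<circ> g \<circ> h') ` (h ` A) = k ` (g ` A)"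
    by (force simp: image_iff)
  ultimately show ?thesis
    using A(1) assms(3) by (auto simp: in_pointclass_iff[OF nice T'] continuous_map_def)
qed

lemma preimage:
  assumes "Polish S" "Polish T" "continuous_map S T g" "in_pointclass \<P> T B"
  shows "in_pointclass \<P> S {s \<in> topspace S. g s \<in> B}"
proof -
  obtain S' :: "real topology" and h where S': "Polish S'" "homeomorphic_map S S' h"
    using Polish_real_copy[OF assms(1)] .
  obtain T' :: "real topology" and k where T': "Polish T'" "homeomorphic_map T T' k"
    using Polish_real_copy[OF assms(2)] .
  obtain h' where h': "homeomorphic_maps S S' h h'"
    using S' homeomorphic_map_maps by blast
  have B: "B \<subseteq> topspace T" "k ` B \<in> \<P> T'"
    using assms(4) in_pointclass_iff[OF nice T'] by auto
  have "continuous_map S' T' (k \<circ> g \<circ> h')"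
    using assms(3) h' T' by (meson continuous_map_compose homeomorphic_imp_continuous_map homeomorphic_maps_def)
  then have "{s \<in> topspace S'. (k \<circ> g \<circ> h') s \<in> k ` B} \<in> \<P> S'"
    by (rule nice_preimage[OF nice S'(1) T'(1) _ B(2)])
  moreover have "h ` {s \<in> topspace S. g s \<in> B} = {s \<in> topspace S'. (k \<circ> g \<circ> h') s \<in> k ` B}"
  proof -
    have inj: "inj_on k (topspace T)"
      using T'(2) homeomorphic_imp_injective_map by blast
    have hh: "\<And>s. s \<in> topspace S \<Longrightarrow> h' (h s) = s" "\<And>s. s \<in> topspace S' \<Longrightarrow> h (h' s) = s"
      "\<And>s. s \<in> topspace S \<Longrightarrow> h s \<in> topspace S'" "\<And>s. s \<in> topspace S' \<Longrightarrow> h' s \<in> topspace S"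
      using h' by (auto simp: homeomorphic_maps_def continuous_map_def)
    have g: "g s \<in> topspace T" if "s \<in> topspace S" for s
      using assms(3) that by (auto simp: continuous_map_def)
    have k: "k (g s) \<in> k ` B \<longleftrightarrow> g s \<in> B" if "s \<in> topspace S" for s
      using inj_on_image_mem_iff[OF inj g[OF that] B(1)] .
    show ?thesis
      using hh k by (auto simp: image_iff) metis
  qed
  ultimately show ?thesis
    by (auto simp: in_pointclass_iff[OF nice S'])
qed

lemma Inter_nat:
  assumes "Polish T" "\<And>n::nat. in_pointclass \<P> T (A n)"
  shows "in_pointclass \<P> T (\<Inter>n. A n)"
proof -
  obtain S :: "real topology" and h where S: "Polish S" "homeomorphic_map T S h"
    using Polish_real_copy[OF assms(1)] .
  have A: "A n \<subseteq> topspace T" "h ` A n \<in> \<P> S" for n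
    using assms(2) in_pointclass_iff[OF nice S] by auto
  have "h ` (\<Inter>n. A n) = (\<Inter>n. h ` A n)"
    using A(1) homeomorphic_imp_injective_map[OF S(2)] by (intro image_INT) auto
  moreover have "(\<Inter>n. A n) \<subseteq> topspace T"
    using A(1)[of 0] by blast
  ultimately show ?thesis
    using nice_Inter[OF nice S(1) A(2)] by (simp add: in_pointclass_iff[OF nice S])
qed

lemma Un:
  assumes "Polish T" "in_pointclass \<P> T A" "in_pointclass \<P> T B"
  shows "in_pointclass \<P> T (A \<union> B)"
proof -
  obtain S :: "real topology" and h where S: "Polish S" "homeomorphic_map T S h"
    using Polish_real_copy[OF assms(1)] .
  show ?thesis
    using assms nice_Un[OF nice S(1)] by (auto simp: in_pointclass_iff[OF nice S] image_Un)
qed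

lemma Inter_countable:
  assumes "Polish T" "countable I" "I \<noteq> {}" "\<And>i. i \<in> I \<Longrightarrow> in_pointclass \<P> T (A i)"
  shows "in_pointclass \<P> T (\<Inter>i\<in>I. A i)"
proof -
  have "(\<Inter>i\<in>I. A i) = (\<Inter>n. A (from_nat_into I n))"
    using range_from_nat_into[OF assms(3,2)] by (metis image_image)
  then show ?thesis
    using assms by (simp add: Inter_nat from_nat_into)
qed

lemma Int:
  assumes "Polish T" "in_pointclass \<P> T A" "in_pointclass \<P> T B"
  shows "in_pointclass \<P> T (A \<inter> B)"
proof -
  have "in_pointclass \<P> T (\<Inter>C\<in>{A, B}. C)"
    using assms by (intro Inter_countable) auto
  then show ?thesis by simp
qed

text \<open>
  Countable unions are not part of the definition of a nice pointclass. They are obtained by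
  projecting \<open>\<Union>\<^sub>n A\<^sub>n \<times> {n} = \<Inter>\<^sub>n (A\<^sub>n \<times> {n} \<union> T \<times> (UNIV - {n}))\<close> from \<open>T \<times> nat\<close>.
\<close>

lemma Union_nat:
  assumes T: "Polish T" and A: "\<And>n::nat. in_pointclass \<P> T (A n)"
  shows "in_pointclass \<P> T (\<Union>n. A n)"
proof -
  define N where "N = (discrete_topology UNIV :: nat topology)"
  have N: "Polish N"
    by (simp add: N_def Polish_discrete)
  note TN = Polish_prod[OF T N]
  have fst: "continuous_map (prod_topology T N) T fst"
    by (simp add: continuous_map_fst)
  define E where "E n = {z \<in> topspace (prod_topology T N). fst z \<in> A n} \<inter> (topspace T \<times> {n})
      \<union> topspace T \<times> (UNIV - {n})" for n
  have "in_pointclass \<P> (prod_topology T N) (E n)" for n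
    unfolding E_def
    by (intro Un Int preimage[OF TN T fst] closed A TN) (auto simp: closedin_prod_Times_iff N_def)
  then have "in_pointclass \<P> (prod_topology T N) (\<Inter>n. E n)"
    by (rule Inter_nat[OF TN])
  then have "in_pointclass \<P> T (fst ` (\<Inter>n. E n))"
    by (rule image[OF TN T fst])
  moreover have "fst ` (\<Inter>n. E n) = (\<Union>n. A n)"
  proof -
    have "(\<Inter>n. E n) = (\<Union>n. A n \<times> {n})"
      using in_pointclass_subset[OF A] by (auto simp: E_def N_def)
    then show ?thesis
      by force
  qed
  ultimately show ?thesis by simp
qed

end

text \<open>Frees the source from being a topology on a set of reals, so that spaces of loops and
  homotopies can serve as witnesses of analyticity.\<close>

lemma analytic_inI:
  assumes "Polish S" "continuous_map S T g"
  shows "analytic_in T (g ` topspace S)"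
proof -
  obtain S' :: "real topology" and h where S': "Polish S'" "homeomorphic_map S S' h"
    using Polish_real_copy[OF assms(1)] .
  obtain h' where h': "homeomorphic_map S' S h'"
    using S'(2) by (meson homeomorphic_map_maps homeomorphic_maps_map)
  have "continuous_map S' T (g \<circ> h')"
    using assms(2) h' by (meson continuous_map_compose homeomorphic_imp_continuous_map)
  moreover have "(g \<circ> h') ` topspace S' = g ` topspace S"
    using homeomorphic_imp_surjective_map[OF h'] by (metis image_comp)
  ultimately show ?thesis
    unfolding analytic_in_def using S'(1) by blast
qed

section \<open>Spaces of continuous maps\<close>

text \<open>Stronger than uniform continuity on \<open>C\<close>, since \<open>z\<close> may lie
  outside \<open>C\<close>: maps close to a given one take values near its compact image, not in it.
  The bound is a Lebesgue number of a cover of \<open>C\<close> by preimages of balls.\<close>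

lemma continuous_map_uniform_near_compact:
  assumes C: "compactin (mtopology_of m1) C"
    and f: "continuous_map (mtopology_of m1) (mtopology_of m2) f" and "\<epsilon> > 0"
  obtains \<delta> where "\<delta> > 0"
    "\<And>c z. c \<in> C \<Longrightarrow> z \<in> mspace m1 \<Longrightarrow> mdist m1 z c < \<delta> \<Longrightarrow> mdist m2 (f z) (f c) < \<epsilon>"
proof -
  interpret M1: Metric_space "mspace m1" "mdist m1" by simp
  interpret M2: Metric_space "mspace m2" "mdist m2" by simp
  have CM: "C \<subseteq> mspace m1"
    using compactin_subset_topspace[OF C] by simp
  have fM: "f z \<in> mspace m2" if "z \<in> mspace m1" for z
    using f that by (auto simp: continuous_map_def)
  \<comment> \<open>Radius \<epsilon>/2, because \<open>f z\<close> and \<open>f c\<close> will be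
    compared through the centre \<open>f a\<close> of a common ball.\<close>
  define U where "U c = {z \<in> mspace m1. f z \<in> M2.mball (f c) (\<epsilon> / 2)}" for c
  have "openin M1.mtopology (U c)" for c
    using openin_continuous_map_preimage[OF f, of "M2.mball (f c) (\<epsilon> / 2)"]
    unfolding U_def topspace_mtopology_of unfolding mtopology_of_def by simp
  moreover have "C \<subseteq> \<Union>(U ` C)"
  proof
    fix c assume c: "c \<in> C"
    then have "c \<in> U c"
      using CM fM \<open>\<epsilon> > 0\<close> by (auto simp: U_def)
    with c show "c \<in> \<Union>(U ` C)" by blast
  qed
  ultimately have "\<exists>\<delta>>0. \<forall>c\<in>C. \<exists>V\<in>U ` C. M1.mball c \<delta> \<subseteq> V"
    using C by (intro M1.lebesgue_number) (auto simp: mtopology_of_def)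
  then obtain \<delta> where \<delta>: "\<delta> > 0" "\<And>c. c \<in> C \<Longrightarrow> \<exists>V\<in>U ` C. M1.mball c \<delta> \<subseteq> V"
    by blast
  have "mdist m2 (f z) (f c) < \<epsilon>" if c: "c \<in> C" and z: "z \<in> mspace m1" "mdist m1 z c < \<delta>" for c z
  proof -
    obtain a where a: "a \<in> C" "M1.mball c \<delta> \<subseteq> U a"
      using \<delta>(2)[OF c] by blast
    have "z \<in> M1.mball c \<delta>" "c \<in> M1.mball c \<delta>"
      using c z CM \<delta>(1) by (auto simp: M1.commute)
    then have "z \<in> U a" "c \<in> U a"
      using a by blast+
    then have "mdist m2 (f a) (f z) < \<epsilon> / 2" "mdist m2 (f a) (f c) < \<epsilon> / 2"
      by (auto simp: U_def)
    moreover have "mdist m2 (f z) (f c) \<le> mdist m2 (f z) (f a) + mdist m2 (f a) (f c)"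
      using M2.triangle fM a c z CM by blast
    ultimately show ?thesis using M2.commute[of "f z" "f a"] by linarith
  qed
  with \<delta>(1) show thesis using that by blast
qed

text \<open>Convergence along arbitrary filters determines a topology, so this form replaces the
  metric both in proofs of continuity and in comparisons of topologies.\<close>

lemma limitin_cfunspace:
  "limitin (mtopology_of (cfunspace T m)) p q F \<longleftrightarrow>
     q \<in> mspace (cfunspace T m) \<and> (\<forall>\<^sub>F t in F. p t \<in> mspace (cfunspace T m)) \<and>
     (\<forall>\<epsilon>>0. \<forall>\<^sub>F t in F. \<forall>k\<in>topspace T. mdist m (p t k) (q k) < \<epsilon>)"
  (is "?L \<longleftrightarrow> ?q \<and> ?p \<and> ?u")
proof -
  let ?C = "cfunspace T m"
  have "?L \<longleftrightarrow> ?q \<and> (\<forall>\<epsilon>>0. \<forall>\<^sub>F t in F. p t \<in> mspace ?C \<and> mdist ?C (p t) q < \<epsilon>)"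
    unfolding mtopology_of_def by (rule Metric_space.limitin_metric[OF Metric_space_mspace_mdist])
  also have "\<dots> \<longleftrightarrow> ?q \<and> ?p \<and> (\<forall>\<epsilon>>0. \<forall>\<^sub>F t in F. mdist ?C (p t) q < \<epsilon>)"
    using zero_less_one by (auto simp only: eventually_conj_iff)
  also have "\<dots> \<longleftrightarrow> ?q \<and> ?p \<and> ?u"
  proof (intro conj_cong refl iffI allI impI)
    assume q: ?q and p: ?p
    fix \<epsilon> :: real assume \<epsilon>: "\<epsilon> > 0"
    {
      assume "\<forall>\<epsilon>>0. \<forall>\<^sub>F t in F. mdist ?C (p t) q < \<epsilon>"
      then have "\<forall>\<^sub>F t in F. mdist ?C (p t) q < \<epsilon> / 2" using \<epsilon> half_gt_zero by blast
      then show "\<forall>\<^sub>F t in F. \<forall>k\<in>topspace T. mdist m (p t k) (q k) < \<epsilon>"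
        using p
      proof eventually_elim
        case (elim t)
        have "mdist m (p t k) (q k) \<le> \<epsilon> / 2" if "k \<in> topspace T" for k
          by (rule mdist_cfunspace_imp_mdist_le[OF elim(2) q less_imp_le[OF elim(1)] that])
        then show ?case using \<epsilon> by force
      qed
    next
      assume "\<forall>\<epsilon>>0. \<forall>\<^sub>F t in F. \<forall>k\<in>topspace T. mdist m (p t k) (q k) < \<epsilon>"
      \<comment> \<open>A supremum of distances below \<epsilon> may be equal to \<epsilon>, hence
        the half.\<close>
      then have "\<forall>\<^sub>F t in F. \<forall>k\<in>topspace T. mdist m (p t k) (q k) < \<epsilon> / 2" using \<epsilon> half_gt_zero by blast
      then show "\<forall>\<^sub>F t in F. mdist ?C (p t) q < \<epsilon>"
      proof eventually_elim
        case (elim t)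
        then have "mdist ?C (p t) q \<le> \<epsilon> / 2"
          using \<epsilon> by (intro mdist_cfunspace_le) force+
        then show ?case using \<epsilon> by simp
      qed
    }
  qed
  finally show ?thesis .
qed

text \<open>A continuous image of a compact set is bounded, so the boundedness built into
  \<open>cfunspace\<close> holds automatically.\<close>

lemma mspace_cfunspace_compact:
  assumes "compact K"
  shows "mspace (cfunspace (top_of_set K) m) =
    {p \<in> extensional K. continuous_map (top_of_set K) (mtopology_of m) p}"
proof -
  have "compactin (top_of_set K) (topspace (top_of_set K))"
    using assms by (simp add: compactin_subtopology)
  then show ?thesis
    by (subst compactin_mspace_cfunspace) (auto simp: continuous_map_def)
qed

text \<open>
  The topology of uniform convergence on a compact set depends only on the topology of the target:
  this is the case where \<open>m1\<close> and \<open>m2\<close> are two metrics for the same topology and \<open>f\<close> is the identity.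
\<close>

lemma continuous_map_cfunspace_compose:
  fixes K :: "'c::topological_space set"
  assumes K: "compact K" and f: "continuous_map (mtopology_of m1) (mtopology_of m2) f"
  shows "continuous_map (mtopology_of (cfunspace (top_of_set K) m1))
    (mtopology_of (cfunspace (top_of_set K) m2)) (\<lambda>p. restrict (f \<circ> p) K)"
  unfolding continuous_map_atin
proof
  let ?C1 = "cfunspace (top_of_set K) m1" and ?C2 = "cfunspace (top_of_set K) m2"
  fix q assume "q \<in> topspace (mtopology_of ?C1)"
  then have q: "q \<in> mspace ?C1" by simp
  have C2: "restrict (f \<circ> p) K \<in> mspace ?C2" if p: "p \<in> mspace ?C1" for p
  proof -
    have "continuous_map (top_of_set K) (mtopology_of m2) (f \<circ> p)"
      using p f K continuous_map_compose by (auto simp: mspace_cfunspace_compact simp del: mspace_cfunspace)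
    then have "continuous_map (top_of_set K) (mtopology_of m2) (restrict (f \<circ> p) K)"
      by (rule continuous_map_eq) auto
    then show ?thesis
      by (simp add: mspace_cfunspace_compact[OF K] del: mspace_cfunspace)
  qed
  \<comment> \<open>Continuity of the identity at \<open>q\<close>, once unfolded, says that
    \<open>p\<close> is uniformly close to \<open>q\<close> along the filter
    \<open>atin\<close>.\<close>
  have lim: "limitin (mtopology_of ?C1) (\<lambda>p. p) q (atin (mtopology_of ?C1) q)"
    using q by (intro limitin_continuous_map continuous_map_id[unfolded id_def]) auto
  note lim = lim[unfolded limitin_cfunspace]
  \<comment> \<open>\<open>f\<close> need not be uniformly continuous, but every \<open>p\<close>
    near \<open>q\<close> takes its values near this compact set, where a uniform estimate is
    available.\<close>
  have comp: "compactin (mtopology_of m1) (q ` K)"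
    using q K by (intro image_compactin[of "top_of_set K"])
      (auto simp: compactin_subtopology mspace_cfunspace_compact simp del: mspace_cfunspace)
  show "limitin (mtopology_of ?C2) (\<lambda>p. restrict (f \<circ> p) K) (restrict (f \<circ> q) K)
      (atin (mtopology_of ?C1) q)"
    unfolding limitin_cfunspace
  proof (intro conjI allI impI)
    show "restrict (f \<circ> q) K \<in> mspace ?C2" using C2 q .
    show "\<forall>\<^sub>F p in atin (mtopology_of ?C1) q. restrict (f \<circ> p) K \<in> mspace ?C2"
      using lim by (auto elim: eventually_mono intro: C2 simp del: mspace_cfunspace)
    fix \<epsilon> :: real assume "\<epsilon> > 0"
    then obtain \<delta> where \<delta>: "\<delta> > 0"
      "\<And>c z. c \<in> q ` K \<Longrightarrow> z \<in> mspace m1 \<Longrightarrow> mdist m1 z c < \<delta> \<Longrightarrow> mdist m2 (f z) (f c) < \<epsilon>"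
      using continuous_map_uniform_near_compact[OF comp f] by metis
    have "\<forall>\<^sub>F p in atin (mtopology_of ?C1) q. p \<in> mspace ?C1"
      "\<forall>\<^sub>F p in atin (mtopology_of ?C1) q. \<forall>k\<in>topspace (top_of_set K). mdist m1 (p k) (q k) < \<delta>"
      using lim \<delta>(1) by blast+
    then show "\<forall>\<^sub>F p in atin (mtopology_of ?C1) q. \<forall>k\<in>topspace (top_of_set K).
        mdist m2 (restrict (f \<circ> p) K k) (restrict (f \<circ> q) K k) < \<epsilon>"
    proof eventually_elim
      case (elim p)
      then show ?case
        using \<delta>(2) by auto
    qed
  qed
qed

text \<open>Allows the given metric of the target to be exchanged for a complete one with the same
  topology.\<close>

lemma mtopology_of_cfunspace_cong:
  assumes "compact K" "mtopology_of m1 = mtopology_of m2"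
  shows "mtopology_of (cfunspace (top_of_set K) m1) = mtopology_of (cfunspace (top_of_set K) m2)"
proof -
  have "continuous_map (mtopology_of (cfunspace (top_of_set K) m)) (mtopology_of (cfunspace (top_of_set K) m')) id"
    if "mtopology_of m = mtopology_of m'" for m m' :: "'b metric"
  proof (rule continuous_map_eq)
    show "continuous_map (mtopology_of (cfunspace (top_of_set K) m))
       (mtopology_of (cfunspace (top_of_set K) m')) (\<lambda>p. restrict (id \<circ> p) K)"
      using that by (intro continuous_map_cfunspace_compose assms) simp
  qed (auto simp: extensional_restrict)
  from this[OF assms(2)] this[OF assms(2)[symmetric]]
  have "homeomorphic_maps (mtopology_of (cfunspace (top_of_set K) m1))
      (mtopology_of (cfunspace (top_of_set K) m2)) id id"
    by (simp add: homeomorphic_maps_def)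
  then show ?thesis
    by (metis homeomorphic_map_id homeomorphic_maps_map)
qed

text \<open>A dense set arises by picking one point from each member of countable covers of ever
  smaller mesh that meets the space. The covering sets may be arbitrary: for function spaces they
  are described by finite data that are not themselves continuous maps, so no dense set is visible
  in advance.\<close>

lemma separable_space_mtopologyI:
  assumes "\<And>\<epsilon>::real. \<epsilon> > 0 \<Longrightarrow> \<exists>\<C>. countable \<C> \<and> mspace m \<subseteq> \<Union>\<C> \<and>
    (\<forall>C\<in>\<C>. \<forall>u\<in>C \<inter> mspace m. \<forall>v\<in>C \<inter> mspace m. mdist m u v < \<epsilon>)"
  shows "separable_space (mtopology_of m)"
proof -
  interpret Metric_space "mspace m" "mdist m" by simp
  have "\<forall>n. \<exists>\<C>. countable \<C> \<and> mspace m \<subseteq> \<Union>\<C> \<and>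
    (\<forall>C\<in>\<C>. \<forall>u\<in>C \<inter> mspace m. \<forall>v\<in>C \<inter> mspace m. mdist m u v < inverse (real (Suc n)))"
    by (intro allI assms) simp
  then obtain \<C> where \<C>: "\<And>n. countable (\<C> n)" "\<And>n. mspace m \<subseteq> \<Union>(\<C> n)"
    "\<And>n C u v. C \<in> \<C> n \<Longrightarrow> u \<in> C \<inter> mspace m \<Longrightarrow> v \<in> C \<inter> mspace m \<Longrightarrow> mdist m u v < inverse (real (Suc n))"
    by metis
  define D where "D = (\<Union>n. (\<lambda>C. SOME u. u \<in> C \<inter> mspace m) ` {C \<in> \<C> n. C \<inter> mspace m \<noteq> {}})"
  have some: "(SOME u. u \<in> C \<inter> mspace m) \<in> C \<inter> mspace m" if "C \<inter> mspace m \<noteq> {}" for C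
    using that by (metis some_in_eq)
  have "countable D"
    unfolding D_def using \<C>(1) by auto
  moreover have "D \<subseteq> mspace m"
    using some by (auto simp: D_def)
  moreover have "z \<in> mtopology closure_of D" if z: "z \<in> mspace m" for z
    unfolding metric_closure_of
  proof (intro CollectI conjI allI impI)
    fix r :: real assume "r > 0"
    then obtain n where n: "inverse (real (Suc n)) < r"
      using reals_Archimedean by blast
    obtain C where C: "C \<in> \<C> n" "z \<in> C" using \<C>(2) z by blast
    define u where "u = (SOME u. u \<in> C \<inter> mspace m)"
    have "u \<in> C \<inter> mspace m" using some C z unfolding u_def by blast
    moreover have "u \<in> D" using C z by (auto simp: D_def u_def)
    moreover have "mdist m z u < r" using \<C>(3)[OF C(1), of z u] calculation C z n by auto
    ultimately show "\<exists>y\<in>D. y \<in> mball z r" using z by auto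
  qed (use z in simp)
  then have "mtopology closure_of D = mspace m"
    using closure_of_subset_topspace[of mtopology D] by auto
  ultimately show ?thesis
    unfolding separable_space_def by (auto simp: mtopology_of_def)
qed

text \<open>
  Maps that are close to the same finitely supported choice of points of a dense set on a finite
  cover of \<open>K\<close> are close to each other, and there are only countably many such choices.
\<close>

lemma separable_space_cfunspace:
  fixes K :: "'c::metric_space set"
  assumes K: "compact K" and sep: "separable_space (mtopology_of m)"
  shows "separable_space (mtopology_of (cfunspace (top_of_set K) m))"
proof (rule separable_space_mtopologyI)
  let ?C = "cfunspace (top_of_set K) m"
  interpret Metric_space "mspace m" "mdist m" by simp
  fix \<epsilon> :: real assume \<epsilon>: "\<epsilon> > 0"
  obtain D where D: "countable D" "D \<subseteq> mspace m" "mtopology closure_of D = mspace m"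
    using sep by (auto simp: separable_space_def mtopology_of_def)
  have dense: "\<exists>a\<in>D. mdist m z a < \<epsilon> / 8" if z: "z \<in> mspace m" for z
  proof -
    have "z \<in> mtopology closure_of D" using D z by simp
    then show ?thesis
      unfolding metric_closure_of using \<epsilon> by (force dest: spec[of _ "\<epsilon> / 8"])
  qed
  have "\<exists>F. finite F \<and> F \<subseteq> K \<and> K \<subseteq> (\<Union>a\<in>F. ball a (inverse (real (Suc n))))" for n
    by (rule compactE_image[OF K, of K "\<lambda>a. ball a (inverse (real (Suc n)))"]) auto
  then obtain F where F: "\<And>n. finite (F n)" "\<And>n. F n \<subseteq> K"
    "\<And>n. K \<subseteq> (\<Union>a\<in>F n. ball a (inverse (real (Suc n))))"
    by metis
  \<comment> \<open>If \<open>p k\<close> is within \<epsilon>/8 of \<open>p a\<close> for all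
    \<open>k\<close> near a node \<open>a\<close>, and \<open>p a\<close> within \<epsilon>/8 of
    \<open>s a\<close>, then \<open>p\<close> lies in \<open>B n s\<close>; two maps in
    \<open>B n s\<close> differ by at most \<epsilon>/2 on \<open>K\<close>. The mesh index
    \<open>n\<close> depends on the modulus of continuity of \<open>p\<close>, so the cover runs
    over all \<open>n\<close>.\<close>
  define B where "B n s = {p. \<forall>a\<in>F n. \<forall>k\<in>K \<inter> ball a (inverse (real (Suc n))). mdist m (p k) (s a) < \<epsilon> / 4}"
    for n s
  define \<C> where "\<C> = (\<Union>n. B n ` (PiE (F n) (\<lambda>_. D)))"
  have "countable \<C>"
    unfolding \<C>_def using F(1) D(1) by (intro countable_UN countable_image countable_PiE) auto
  moreover have "mspace ?C \<subseteq> \<Union>\<C>"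
  proof
    fix p assume "p \<in> mspace ?C"
    then have p: "continuous_map (top_of_set K) (mtopology_of m) p"
      by (simp add: mspace_cfunspace_compact[OF K] del: mspace_cfunspace)
    \<comment> \<open>With \<open>K\<close> itself as the metric space, the estimate near a compact
      set becomes uniform continuity of \<open>p\<close>.\<close>
    let ?m1 = "submetric euclidean_metric K"
    have "compactin (mtopology_of ?m1) K"
      using K by (simp add: mtopology_of_submetric compactin_subtopology)
    moreover have "continuous_map (mtopology_of ?m1) (mtopology_of m) p"
      using p by (simp add: mtopology_of_submetric)
    moreover have "\<epsilon> / 8 > 0" using \<epsilon> by simp
    ultimately obtain \<delta> where \<delta>: "\<delta> > 0"
      "\<And>c z. c \<in> K \<Longrightarrow> z \<in> mspace ?m1 \<Longrightarrow> mdist ?m1 z c < \<delta> \<Longrightarrow> mdist m (p z) (p c) < \<epsilon> / 8"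
      by (rule continuous_map_uniform_near_compact) blast
    obtain n where n: "inverse (real (Suc n)) < \<delta>"
      using reals_Archimedean \<delta> by blast
    have pK: "p k \<in> mspace m" if "k \<in> K" for k
      using p that by (auto simp: continuous_map_def)
    obtain s where s: "\<And>a. a \<in> K \<Longrightarrow> s a \<in> D" "\<And>a. a \<in> K \<Longrightarrow> mdist m (p a) (s a) < \<epsilon> / 8"
      using bchoice[of K "\<lambda>k a. a \<in> D \<and> mdist m (p k) a < \<epsilon> / 8"] dense pK by blast
    have "p \<in> B n (restrict s (F n))"
      unfolding B_def
    proof (intro CollectI ballI)
      fix a k assume ak: "a \<in> F n" "k \<in> K \<inter> ball a (inverse (real (Suc n)))"
      then have a: "a \<in> K" "k \<in> K" "dist k a < \<delta>" using F(2) n by (auto simp: dist_commute)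
      then have "mdist m (p k) (p a) < \<epsilon> / 8" using \<delta>(2)[of a k] by simp
      moreover have "mdist m (p k) (s a) \<le> mdist m (p k) (p a) + mdist m (p a) (s a)"
        using a s D pK by (intro triangle) auto
      ultimately show "mdist m (p k) (restrict s (F n) a) < \<epsilon> / 4" using s(2)[OF a(1)] ak by simp
    qed
    moreover have "restrict s (F n) \<in> PiE (F n) (\<lambda>_. D)"
      using s(1) F(2) unfolding restrict_PiE_iff by blast
    ultimately show "p \<in> \<Union>\<C>" unfolding \<C>_def by blast
  qed
  moreover have "mdist ?C u v < \<epsilon>" if C: "C \<in> \<C>" and u: "u \<in> C \<inter> mspace ?C" and v: "v \<in> C \<inter> mspace ?C" for C u v
  proof -
    obtain n s where s: "s \<in> PiE (F n) (\<lambda>_. D)" "C = B n s" using C by (auto simp: \<C>_def)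
    have "mdist m (u k) (v k) \<le> \<epsilon> / 2" if k: "k \<in> topspace (top_of_set K)" for k
    proof -
      obtain a where a: "a \<in> F n" "k \<in> K \<inter> ball a (inverse (real (Suc n)))" using k F(3)[of n] by auto
      have "mdist m (u k) (s a) < \<epsilon> / 4" "mdist m (v k) (s a) < \<epsilon> / 4"
        using u v a unfolding s B_def by blast+
      moreover have "mdist m (u k) (v k) \<le> mdist m (u k) (s a) + mdist m (s a) (v k)"
        using u v s a D k by (intro triangle) auto
      ultimately show ?thesis using commute[of "s a" "v k"] by linarith
    qed
    then have "mdist ?C u v \<le> \<epsilon> / 2" using \<epsilon> by (intro mdist_cfunspace_le) auto
    then show ?thesis using \<epsilon> by simp
  qed
  ultimately show "\<exists>\<C>. countable \<C> \<and> mspace ?C \<subseteq> \<Union>\<C> \<and>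
    (\<forall>C\<in>\<C>. \<forall>u\<in>C \<inter> mspace ?C. \<forall>v\<in>C \<inter> mspace ?C. mdist ?C u v < \<epsilon>)"
    by blast
qed

text \<open>The values are confined to \<open>X\<close> through the metric of the target, so that
  Polishness of \<open>X\<close> can be applied. In \<open>loop_space\<close> the target is the
  whole type; \<open>loop_space_eq_subtopology\<close> reconciles the two constructions.\<close>

definition map_space :: "'c::metric_space set \<Rightarrow> 'a::metric_space set \<Rightarrow> ('c \<Rightarrow> 'a) topology" where
  "map_space K X = mtopology_of (cfunspace (top_of_set K) (submetric euclidean_metric X))"

lemma topspace_map_space:
  assumes "compact K"
  shows "topspace (map_space K X) = {p \<in> extensional K. continuous_on K p \<and> p ` K \<subseteq> X}"
proof -
  have "topspace (map_space K X) = mspace (cfunspace (top_of_set K) (submetric euclidean_metric X))"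
    by (simp add: map_space_def)
  also have "\<dots> = {p \<in> extensional K. continuous_on K p \<and> p ` K \<subseteq> X}"
    unfolding mspace_cfunspace_compact[OF assms] mtopology_of_submetric mtopology_of_euclidean
      continuous_map_in_subtopology by auto
  finally show ?thesis .
qed

lemma limitin_map_space:
  assumes K: "compact K"
  shows "limitin (map_space K X) p q F \<longleftrightarrow>
    q \<in> topspace (map_space K X) \<and> (\<forall>\<^sub>F t in F. p t \<in> topspace (map_space K X)) \<and> uniform_limit K p q F"
  unfolding map_space_def limitin_cfunspace topspace_mtopology_of
  by (simp add: uniform_limit_iff del: mspace_cfunspace)

lemma continuous_map_map_space:
  assumes K: "compact K"
  shows "continuous_map T (map_space K X) \<Phi> \<longleftrightarrow>
    (\<forall>t\<in>topspace T. \<Phi> t \<in> topspace (map_space K X) \<and> uniform_limit K \<Phi> (\<Phi> t) (atin T t))"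
proof -
  have "\<forall>\<^sub>F u in atin T t. \<Phi> u \<in> topspace (map_space K X)"
    if "t \<in> topspace T" "\<forall>t\<in>topspace T. \<Phi> t \<in> topspace (map_space K X)" for t
    using that by (auto simp: eventually_atin)
  then show ?thesis
    unfolding continuous_map_atin limitin_map_space[OF K] by blast
qed

lemma Polish_map_space:
  assumes K: "compact K" and X: "Polish (top_of_set X)"
  shows "Polish (map_space K X)"
  unfolding Polish_def
proof
  show "separable_space (map_space K X)"
    unfolding map_space_def using X
    by (intro separable_space_cfunspace K) (simp add: mtopology_of_submetric Polish_def)
  \<comment> \<open>The metric inherited by \<open>X\<close> may be incomplete; \<open>d\<close> is
    a complete metric for the same topology and replaces it in the sup metric.\<close>
  obtain M d where M: "Metric_space M d" "Metric_space.mcomplete M d"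
    and eq: "top_of_set X = Metric_space.mtopology M d"
    using X by (auto simp: Polish_def completely_metrizable_space_def)
  interpret Metric_space M d by fact
  have "mtopology_of (submetric euclidean_metric X) = mtopology_of Self"
    unfolding mtopology_of_submetric mtopology_of_euclidean eq by (simp add: mtopology_of_def)
  then have "map_space K X = mtopology_of (cfunspace (top_of_set K) Self)"
    unfolding map_space_def by (intro mtopology_of_cfunspace_cong K)
  moreover have "completely_metrizable_space (mtopology_of (cfunspace (top_of_set K) Self))"
    using mcomplete_cfunspace[OF M(2), of "top_of_set K"]
    unfolding mtopology_of_def mcomplete_of_def
    by (rule Metric_space.completely_metrizable_space_mtopology[OF Metric_space_mspace_mdist])
  ultimately show "completely_metrizable_space (map_space K X)" by simp
qed

lemma continuous_map_eval_map_space: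
  assumes K: "compact K" and k: "k \<in> K"
  shows "continuous_map (map_space K X) euclidean (\<lambda>p. p k)"
  unfolding continuous_map_atin
proof
  fix q assume "q \<in> topspace (map_space K X)"
  then have "uniform_limit K (\<lambda>p. p) q (atin (map_space K X) q)"
    using continuous_map_map_space[OF K, of "map_space K X" X "\<lambda>p. p"] by auto
  then show "limitin euclidean (\<lambda>p. p k) (q k) (atin (map_space K X) q)"
    using k tendsto_uniform_limitI by fastforce
qed

text \<open>Reparametrization does not increase uniform distance. Reversing a loop (by
  \<open>1 - s\<close>) and slicing a homotopy (by \<open>Pair s\<close>) are the two
  instances.\<close>

lemma continuous_map_precompose_map_space:
  fixes \<phi> :: "'d::metric_space \<Rightarrow> 'c::metric_space"
  assumes K: "compact K" and K': "compact K'" and \<phi>: "continuous_on K' \<phi>" "\<phi> ` K' \<subseteq> K"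
    and T: "continuous_map T (map_space K X) \<Phi>"
  shows "continuous_map T (map_space K' X) (\<lambda>t. restrict (\<Phi> t \<circ> \<phi>) K')"
  unfolding continuous_map_map_space[OF K']
proof (intro ballI conjI)
  fix t assume t: "t \<in> topspace T"
  then have *: "continuous_on K (\<Phi> t)" "\<Phi> t ` K \<subseteq> X" and u: "uniform_limit K \<Phi> (\<Phi> t) (atin T t)"
    using T by (auto simp: continuous_map_map_space[OF K] topspace_map_space[OF K])
  have "continuous_on K' (\<Phi> t \<circ> \<phi>)"
    using *(1) \<phi> continuous_on_compose continuous_on_subset by blast
  then have "continuous_on K' (restrict (\<Phi> t \<circ> \<phi>) K')"
    by (rule continuous_on_eq) simp
  then show "restrict (\<Phi> t \<circ> \<phi>) K' \<in> topspace (map_space K' X)"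
    using * \<phi> by (auto simp: topspace_map_space[OF K'])
  show "uniform_limit K' (\<lambda>t. restrict (\<Phi> t \<circ> \<phi>) K') (restrict (\<Phi> t \<circ> \<phi>) K') (atin T t)"
    unfolding uniform_limit_iff
  proof (intro allI impI)
    fix e :: real assume "e > 0"
    then have "\<forall>\<^sub>F s in atin T t. \<forall>k\<in>K. dist (\<Phi> s k) (\<Phi> t k) < e"
      using u by (auto simp: uniform_limit_iff)
    then show "\<forall>\<^sub>F s in atin T t. \<forall>k\<in>K'. dist (restrict (\<Phi> s \<circ> \<phi>) K' k) (restrict (\<Phi> t \<circ> \<phi>) K' k) < e"
      by eventually_elim (use \<phi> in auto)
  qed
qed

section \<open>Loop spaces\<close>

lemma topology_eqI_limitin:
  assumes "\<And>q F. limitin S (\<lambda>z. z) q F \<longleftrightarrow> limitin T (\<lambda>z. z) q F"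
  shows "S = T"
proof -
  \<comment> \<open>Along \<open>bot\<close> every eventual condition holds, so the limits are
    exactly the points of the space.\<close>
  have top: "topspace S = topspace T"
    using assms[of _ bot] by (auto simp: limitin_def)
  have "continuous_map A B id"
    if "\<And>q F. limitin A (\<lambda>z. z) q F \<longleftrightarrow> limitin B (\<lambda>z. z) q F" for A B :: "'a topology"
    using continuous_map_id[of A, unfolded continuous_map_atin] unfolding continuous_map_atin
    by (simp add: id_def that)
  from this[of S T] this[of T S] have "homeomorphic_maps S T id id"
    using assms by (simp add: homeomorphic_maps_def)
  then have "homeomorphic_map S T id"
    unfolding homeomorphic_maps_map by blast
  then show ?thesis
    by simp
qed

lemma loops_subset_map_space: "loops X x \<subseteq> topspace (map_space {0..1} X)"
  by (auto simp: loops_def topspace_map_space path_def path_image_def)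

lemma loop_space_eq_subtopology: "loop_space X x = subtopology (map_space {0..1} X) (loops X x)"
proof (rule topology_eqI_limitin)
  fix q and F :: "(real \<Rightarrow> 'a) filter"
  let ?C = "cfunspace (top_of_set {0..1::real}) (euclidean_metric :: 'a metric)"
  have C: "loops X x \<subseteq> mspace ?C"
    by (subst mspace_cfunspace_compact) (auto simp: loops_def path_def)
  have "limitin (loop_space X x) (\<lambda>z. z) q F \<longleftrightarrow>
      q \<in> loops X x \<and> (\<forall>\<^sub>F p in F. p \<in> loops X x) \<and> limitin (mtopology_of ?C) (\<lambda>z. z) q F"
    by (simp add: loop_space_def mtopology_of_submetric limitin_subtopology)
  also have "\<dots> \<longleftrightarrow> q \<in> loops X x \<and> (\<forall>\<^sub>F p in F. p \<in> loops X x) \<and> uniform_limit {0..1} (\<lambda>z. z) q F"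
    unfolding limitin_cfunspace using C
    by (auto simp: uniform_limit_iff simp del: mspace_cfunspace elim: eventually_mono)
  also have "\<dots> \<longleftrightarrow> limitin (subtopology (map_space {0..1} X) (loops X x)) (\<lambda>z. z) q F"
    unfolding limitin_subtopology limitin_map_space[OF compact_Icc]
    using loops_subset_map_space[of X x] by (auto elim: eventually_mono)
  finally show "limitin (loop_space X x) (\<lambda>z. z) q F \<longleftrightarrow>
      limitin (subtopology (map_space {0..1} X) (loops X x)) (\<lambda>z. z) q F" .
qed

text \<open>Evaluation is continuous, so prescribing the value at both ends cuts out a closed
  subspace.\<close>

lemma Polish_loop_space:
  assumes "Polish (top_of_set X)"
  shows "Polish (loop_space X x)"
proof -
  let ?T = "map_space {0..1::real} X"
  have "closedin ?T {p \<in> topspace ?T. p k \<in> {x}}" if "k \<in> {0..1}" for k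
    using closedin_continuous_map_preimage[OF continuous_map_eval_map_space[OF compact_Icc that], of "{x}"]
    by simp
  then have "closedin ?T ({p \<in> topspace ?T. p 0 \<in> {x}} \<inter> {p \<in> topspace ?T. p 1 \<in> {x}})"
    by (intro closedin_Int) auto
  moreover have "{p \<in> topspace ?T. p 0 \<in> {x}} \<inter> {p \<in> topspace ?T. p 1 \<in> {x}} = loops X x"
    by (auto simp: loops_def topspace_map_space path_def path_image_def pathstart_def pathfinish_def)
  ultimately show ?thesis
    unfolding loop_space_eq_subtopology using assms by (simp add: Polish_closedin Polish_map_space)
qed

lemma continuous_map_loop_space:
  "continuous_map T (loop_space X x) \<Phi> \<longleftrightarrow>
    (\<forall>t\<in>topspace T. \<Phi> t \<in> loops X x \<and> uniform_limit {0..1} \<Phi> (\<Phi> t) (atin T t))"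
  unfolding loop_space_eq_subtopology continuous_map_in_subtopology
    continuous_map_map_space[OF compact_Icc]
  using loops_subset_map_space by blast

text \<open>Stated for continuous families over a parameter space \<open>T\<close>, as is
  \<open>continuous_map_loop_join\<close>, so that the two can be chained in an induction on words
  with \<open>T\<close> a power of the loop space.\<close>

lemma continuous_map_loop_reverse:
  assumes "continuous_map T (loop_space X x) P"
  shows "continuous_map T (loop_space X x) (\<lambda>t. restrict (reversepath (P t)) {0..1})"
proof -
  have P: "continuous_map T (map_space {0..1} X) P" "\<And>t. t \<in> topspace T \<Longrightarrow> P t \<in> loops X x"
    using assms by (auto simp: loop_space_eq_subtopology continuous_map_in_subtopology)
  have "continuous_map T (map_space {0..1} X) (\<lambda>t. restrict (P t \<circ> (\<lambda>s. 1 - s)) {0..1})"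
    by (rule continuous_map_precompose_map_space[OF _ _ _ _ P(1)]) (auto intro!: continuous_on_op_minus)
  moreover have "P t \<circ> (\<lambda>s. 1 - s) = reversepath (P t)" for t
    by (auto simp: reversepath_def)
  moreover have "restrict (reversepath (P t)) {0..1} \<in> loops X x" if "t \<in> topspace T" for t
    using P(2)[OF that] loop_class_nonempty[of "reversepath (P t)" X x]
    by (simp add: loops_def loop_class_def)
  ultimately show ?thesis
    by (simp add: loop_space_eq_subtopology continuous_map_in_subtopology)
qed

lemma continuous_map_loop_join:
  assumes "continuous_map T (loop_space X x) P" "continuous_map T (loop_space X x) Q"
  shows "continuous_map T (loop_space X x) (\<lambda>t. restrict (P t +++ Q t) {0..1})"
  unfolding continuous_map_loop_space
proof (intro ballI conjI)
  fix t assume t: "t \<in> topspace T"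
  then have P: "P t \<in> loops X x" "uniform_limit {0..1} P (P t) (atin T t)"
    and Q: "Q t \<in> loops X x" "uniform_limit {0..1} Q (Q t) (atin T t)"
    using assms by (auto simp: continuous_map_loop_space)
  show "restrict (P t +++ Q t) {0..1} \<in> loops X x"
    using P(1) Q(1) loop_class_nonempty[of "P t +++ Q t" X x]
    by (simp add: loops_def loop_class_def path_image_join)
  show "uniform_limit {0..1} (\<lambda>t. restrict (P t +++ Q t) {0..1}) (restrict (P t +++ Q t) {0..1}) (atin T t)"
    unfolding uniform_limit_iff
  proof (intro allI impI)
    fix e :: real assume "e > 0"
    then have "\<forall>\<^sub>F s in atin T t. \<forall>k\<in>{0..1}. dist (P s k) (P t k) < e"
      "\<forall>\<^sub>F s in atin T t. \<forall>k\<in>{0..1}. dist (Q s k) (Q t k) < e"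
      using P(2) Q(2) by (auto simp: uniform_limit_iff)
    then show "\<forall>\<^sub>F s in atin T t. \<forall>k\<in>{0..1}.
        dist (restrict (P s +++ Q s) {0..1} k) (restrict (P t +++ Q t) {0..1} k) < e"
      by eventually_elim (auto simp: joinpaths_def)
  qed
qed

lemma continuous_map_loop_compose:
  fixes f :: "'a::metric_space \<Rightarrow> 'b::metric_space"
  assumes f: "continuous_on X f" "f ` X \<subseteq> Y" "f x = y"
  shows "continuous_map (loop_space X x) (loop_space Y y) (\<lambda>p. restrict (f \<circ> p) {0..1})"
proof -
  have "continuous_map (map_space {0..1} X) (map_space {0..1} Y) (\<lambda>p. restrict (f \<circ> p) {0..1::real})"
    unfolding map_space_def using f(1,2)
    by (intro continuous_map_cfunspace_compose compact_Icc)
       (auto simp: mtopology_of_submetric continuous_map_in_subtopology)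
  moreover have "restrict (f \<circ> p) {0..1} \<in> loops Y y" if p: "p \<in> loops X x" for p
  proof -
    have "path (f \<circ> p)" "path_image (f \<circ> p) \<subseteq> Y" "pathstart (f \<circ> p) = y" "pathfinish (f \<circ> p) = y"
      using p f by (auto simp: loops_def path_image_compose pathstart_compose pathfinish_compose
        intro: path_continuous_image continuous_on_subset)
    from loop_class_nonempty[OF this] show ?thesis
      by (simp add: loop_class_def)
  qed
  ultimately show ?thesis
    by (auto simp: loop_space_eq_subtopology continuous_map_in_subtopology
      intro: continuous_map_from_subtopology)
qed

section \<open>Based homotopies and saturation under homotopy\<close>

definition homotopy_space :: "'a::metric_space set \<Rightarrow> 'a \<Rightarrow> (real \<times> real \<Rightarrow> 'a) topology" where
  "homotopy_space X x = subtopology (map_space ({0..1} \<times> {0..1}) X)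
    (\<Inter>s\<in>{0..1}. {h. h (s, 0) = x \<and> h (s, 1) = x})"

text \<open>The first coordinate of a homotopy is time, the second the parameter of the loop, as in
  \<open>homotopic_paths\<close>.\<close>

definition slice :: "real \<Rightarrow> (real \<times> real \<Rightarrow> 'a) \<Rightarrow> real \<Rightarrow> 'a" where
  "slice s h = restrict (\<lambda>t. h (s, t)) {0..1}"

lemma topspace_homotopy_space:
  "topspace (homotopy_space X x) = {h \<in> extensional ({0..1} \<times> {0..1}).
     continuous_on ({0..1} \<times> {0..1}) h \<and> h ` ({0..1} \<times> {0..1}) \<subseteq> X \<and>
     (\<forall>s\<in>{0..1}. h (s, 0) = x \<and> h (s, 1) = x)}"
  by (auto simp: homotopy_space_def topspace_map_space compact_Times)

lemma Polish_homotopy_space: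
  assumes "Polish (top_of_set X)"
  shows "Polish (homotopy_space X x)"
proof -
  let ?T = "map_space ({0..1::real} \<times> {0..1::real}) X"
  have K: "compact ({0..1::real} \<times> {0..1::real})" by (simp add: compact_Times)
  have "closedin ?T {h \<in> topspace ?T. h k \<in> {x}}" if "k \<in> {0..1} \<times> {0..1}" for k
    using closedin_continuous_map_preimage[OF continuous_map_eval_map_space[OF K that], of "{x}"]
    by simp
  then have "closedin ?T (\<Inter>k\<in>{0..1} \<times> {0, 1}. {h \<in> topspace ?T. h k \<in> {x}})"
    by (intro closedin_INT) auto
  moreover have "(\<Inter>k\<in>{0..1} \<times> {0, 1}. {h \<in> topspace ?T. h k \<in> {x}}) =
      topspace ?T \<inter> (\<Inter>s\<in>{0..1}. {h. h (s, 0) = x \<and> h (s, 1) = x})"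
    by fastforce
  ultimately have "Polish (subtopology ?T (topspace ?T \<inter> (\<Inter>s\<in>{0..1}. {h. h (s, 0) = x \<and> h (s, 1) = x})))"
    by (intro Polish_closedin Polish_map_space K assms) simp
  then show ?thesis
    unfolding homotopy_space_def subtopology_restrict .
qed

lemma continuous_map_slice:
  assumes s: "s \<in> {0..1}"
  shows "continuous_map (homotopy_space X x) (loop_space X x) (slice s)"
proof -
  have K: "compact ({0..1::real} \<times> {0..1::real})" by (simp add: compact_Times)
  have "continuous_map (homotopy_space X x) (map_space ({0..1} \<times> {0..1}) X) (\<lambda>h. h)"
    unfolding homotopy_space_def
    by (rule continuous_map_from_subtopology[OF continuous_map_id[unfolded id_def]])
  then have "continuous_map (homotopy_space X x) (map_space {0..1} X) (\<lambda>h. restrict (h \<circ> Pair s) {0..1})"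
    using s by (intro continuous_map_precompose_map_space[OF K compact_Icc]) (auto intro!: continuous_on_Pair)
  then have cont: "continuous_map (homotopy_space X x) (map_space {0..1} X) (slice s)"
    by (rule continuous_map_eq) (auto simp: slice_def)
  have "slice s h \<in> loops X x" if h: "h \<in> topspace (homotopy_space X x)" for h
  proof -
    have "slice s h \<in> topspace (map_space {0..1} X)"
      using continuous_map_image_subset_topspace[OF cont] h by blast
    then show ?thesis
      using h s by (auto simp: loops_def topspace_map_space path_def path_image_def pathstart_def
        pathfinish_def topspace_homotopy_space slice_def)
  qed
  with cont show ?thesis
    by (auto simp: loop_space_eq_subtopology continuous_map_in_subtopology)
qed

text \<open>Exhibits the homotopy relation on loops as the image of a Polish space under the pair of
  end slices. Extensionality of loops turns the pointwise end conditions into equations between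
  functions.\<close>

lemma homotopic_paths_iff_slices:
  assumes "p \<in> loops X x" "q \<in> loops X x"
  shows "homotopic_paths X p q \<longleftrightarrow> (\<exists>h\<in>topspace (homotopy_space X x). slice 0 h = p \<and> slice 1 h = q)"
proof
  have ends: "pathstart p = x" "pathfinish p = x" and ext: "p \<in> extensional {0..1}" "q \<in> extensional {0..1}"
    using assms by (auto simp: loops_def)
  {
    assume "homotopic_paths X p q"
    then obtain h where h: "continuous_on ({0..1} \<times> {0..1}) h" "h \<in> ({0..1} \<times> {0..1}) \<rightarrow> X"
      "\<forall>t\<in>{0..1}. h (0, t) = p t" "\<forall>t\<in>{0..1}. h (1, t) = q t"
      "\<forall>s\<in>{0..1::real}. pathstart (h \<circ> Pair s) = x \<and> pathfinish (h \<circ> Pair s) = x"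
      using ends by (auto simp: homotopic_paths)
    define H where "H = restrict h ({0..1} \<times> {0..1})"
    have "continuous_on ({0..1} \<times> {0..1}) H"
      using h(1) by (rule continuous_on_eq) (simp add: H_def)
    then have "H \<in> topspace (homotopy_space X x)"
      using h(2,5) by (auto simp: topspace_homotopy_space H_def pathstart_def pathfinish_def)
    moreover have "slice 0 H = p" "slice 1 H = q"
      using h(3,4) ext by (auto simp: slice_def H_def intro!: extensionalityI[of _ "{0..1}"])
    ultimately show "\<exists>h\<in>topspace (homotopy_space X x). slice 0 h = p \<and> slice 1 h = q"
      by blast
  next
    assume "\<exists>h\<in>topspace (homotopy_space X x). slice 0 h = p \<and> slice 1 h = q"
    then obtain h where h: "h \<in> topspace (homotopy_space X x)" "slice 0 h = p" "slice 1 h = q"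
      by blast
    then show "homotopic_paths X p q"
      unfolding homotopic_paths using ends
      by (intro exI[of _ h])
        (auto simp: topspace_homotopy_space slice_def pathstart_def pathfinish_def)
  }
qed

definition homotopy_saturation :: "'a::topological_space set \<Rightarrow> 'a \<Rightarrow> (real \<Rightarrow> 'a) set \<Rightarrow> (real \<Rightarrow> 'a) set" where
  "homotopy_saturation X x A = \<Union>(loop_class X x ` A)"

lemma homotopy_saturation_eq_slices:
  assumes "A \<subseteq> loops X x"
  shows "homotopy_saturation X x A = slice 1 ` {h \<in> topspace (homotopy_space X x). slice 0 h \<in> A}"
proof -
  have "slice s h \<in> loops X x" if "h \<in> topspace (homotopy_space X x)" "s \<in> {0..1}" for s h
    using continuous_map_image_subset_topspace[OF continuous_map_slice[of s X x]] that by auto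
  then have *: "q \<in> loop_class X x p \<longleftrightarrow> (\<exists>h\<in>topspace (homotopy_space X x). slice 0 h = p \<and> slice 1 h = q)"
    if "p \<in> A" for p q
    using assms that homotopic_paths_iff_slices[of p X x q] by (auto simp: loop_class_def)
  show ?thesis
    unfolding homotopy_saturation_def
  proof (intro subset_antisym subsetI)
    fix q assume "q \<in> \<Union>(loop_class X x ` A)"
    then obtain p h where "p \<in> A" "h \<in> topspace (homotopy_space X x)" "slice 0 h = p" "slice 1 h = q"
      using * by auto
    then show "q \<in> slice 1 ` {h \<in> topspace (homotopy_space X x). slice 0 h \<in> A}"
      by auto
  next
    fix q assume "q \<in> slice 1 ` {h \<in> topspace (homotopy_space X x). slice 0 h \<in> A}"
    then obtain h where "h \<in> topspace (homotopy_space X x)" "slice 0 h \<in> A" "slice 1 h = q"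
      by auto
    then show "q \<in> \<Union>(loop_class X x ` A)"
      using *[of "slice 0 h" q] by blast
  qed
qed

lemma (in nice_class) homotopy_saturation:
  assumes X: "Polish (top_of_set X)" and A: "in_pointclass \<P> (loop_space X x) A"
  shows "in_pointclass \<P> (loop_space X x) (homotopy_saturation X x A)"
proof -
  note pol = Polish_homotopy_space[OF X, of x] Polish_loop_space[OF X, of x]
  have "A \<subseteq> loops X x"
    using in_pointclass_subset[OF A] by simp
  then show ?thesis
    unfolding homotopy_saturation_eq_slices[OF \<open>A \<subseteq> loops X x\<close>]
    by (intro image[OF pol] preimage[OF pol] continuous_map_slice A) auto
qed

section \<open>Definable subsets of the fundamental group\<close>

lemma loop_class_self: "p \<in> loops X x \<Longrightarrow> p \<in> loop_class X x p"
  by (simp add: loop_class_def loops_def homotopic_paths_refl)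

lemma loop_class_carrier: "p \<in> loops X x \<Longrightarrow> loop_class X x p \<in> carrier (fundamental_group X x)"
  by (simp add: fundamental_group_def)

lemma carrier_eq_loop_class:
  assumes "a \<in> carrier (fundamental_group X x)" "p \<in> a"
  shows "a = loop_class X x p" "p \<in> loops X x"
  using assms by (auto simp: fundamental_group_def dest: loop_class_eq simp: loop_class_def)
    (auto dest: homotopic_paths_trans homotopic_paths_sym)

lemma carrier_nonempty: "a \<in> carrier (fundamental_group X x) \<Longrightarrow> a \<noteq> {}"
  using loop_class_self by (fastforce simp: fundamental_group_def)

text \<open>Distinct classes are disjoint, so a set of classes can be recovered from its union. This
  is why forming the union commutes with intersections and inverse images of sets of
  classes.\<close>

lemma Union_classes:
  assumes "A \<subseteq> carrier (fundamental_group X x)"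
  shows "\<Union>A = {p \<in> loops X x. loop_class X x p \<in> A}"
  using assms carrier_eq_loop_class[of _ X x] loop_class_self by blast

lemma loop_class_image_Union:
  assumes "A \<subseteq> carrier (fundamental_group X x)"
  shows "loop_class X x ` \<Union>A = A"
  using carrier_nonempty[of _ X x] carrier_eq_loop_class[of _ X x] assms
  unfolding Union_classes[OF assms] by (auto simp: image_iff) (metis assms ex_in_conv subset_iff)

lemma loop_class_restrict:
  assumes "path p" "path_image p \<subseteq> X"
  shows "loop_class X x (restrict p {0..1}) = loop_class X x p"
  using assms by (intro loop_class_eq homotopic_paths_sym[OF homotopic_paths_eq]) auto

lemma restrict_loop:
  assumes "path p" "path_image p \<subseteq> X" "pathstart p = x" "pathfinish p = x"
  shows "restrict p {0..1} \<in> loops X x"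
  using loop_class_nonempty[OF assms] by (simp add: loop_class_def)

lemma loop_class_join:
  assumes "p \<in> loops X x" "q \<in> loops X x"
  shows "restrict (p +++ q) {0..1} \<in> loops X x"
    and "loop_class X x (restrict (p +++ q) {0..1}) =
      loop_class X x p \<otimes>\<^bsub>fundamental_group X x\<^esub> loop_class X x q"
proof -
  have "path (p +++ q)" "path_image (p +++ q) \<subseteq> X" "pathstart (p +++ q) = x" "pathfinish (p +++ q) = x"
    using assms by (auto simp: loops_def path_image_join)
  note pq = this
  show "restrict (p +++ q) {0..1} \<in> loops X x"
    by (rule restrict_loop[OF pq])
  show "loop_class X x (restrict (p +++ q) {0..1}) =
      loop_class X x p \<otimes>\<^bsub>fundamental_group X x\<^esub> loop_class X x q"
    using assms by (subst loop_class_restrict[OF pq(1,2)]) (simp add: loop_class_mult loops_def)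
qed

lemma const_loop:
  assumes "x \<in> X"
  shows "restrict (\<lambda>_. x) {0..1} \<in> loops X x"
    and "loop_class X x (restrict (\<lambda>_. x) {0..1}) = \<one>\<^bsub>fundamental_group X x\<^esub>"
proof -
  have "path (\<lambda>_::real. x)" "path_image (\<lambda>_::real. x) \<subseteq> X"
    "pathstart (\<lambda>_::real. x) = x" "pathfinish (\<lambda>_::real. x) = x"
    using assms by (auto simp: path_def path_image_def pathstart_def pathfinish_def)
  then show "restrict (\<lambda>_. x) {0..1} \<in> loops X x"
    "loop_class X x (restrict (\<lambda>_. x) {0..1}) = \<one>\<^bsub>fundamental_group X x\<^esub>"
    by (simp_all only: restrict_loop loop_class_restrict) (simp add: fundamental_group_def)
qed

lemma loop_class_reverse:
  assumes x: "x \<in> X" and p: "p \<in> loops X x"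
  shows "restrict (reversepath p) {0..1} \<in> loops X x"
    and "loop_class X x (restrict (reversepath p) {0..1}) = inv\<^bsub>fundamental_group X x\<^esub> loop_class X x p"
proof -
  let ?\<pi> = "fundamental_group X x"
  interpret group ?\<pi> by (rule group_fundamental_group[OF x])
  have r: "path (reversepath p)" "path_image (reversepath p) \<subseteq> X"
    "pathstart (reversepath p) = x" "pathfinish (reversepath p) = x"
    using p by (auto simp: loops_def)
  then show loop: "restrict (reversepath p) {0..1} \<in> loops X x"
    by (rule restrict_loop)
  have "loop_class X x (reversepath p) \<otimes>\<^bsub>?\<pi>\<^esub> loop_class X x p = loop_class X x (reversepath p +++ p)"
    using r p by (intro loop_class_mult) (auto simp: loops_def)
  also have "\<dots> = \<one>\<^bsub>?\<pi>\<^esub>"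
    using p loop_class_eq[OF homotopic_reversepath_join[of p X x]]
    by (simp add: loops_def fundamental_group_def)
  finally show "loop_class X x (restrict (reversepath p) {0..1}) = inv\<^bsub>?\<pi>\<^esub> loop_class X x p"
    using inv_equality[of "loop_class X x (restrict (reversepath p) {0..1})" "loop_class X x p"]
      loop_class_carrier[OF p] loop_class_carrier[OF loop] r
    by (simp add: loop_class_restrict)
qed

text \<open>Mirrors \<open>eval_word\<close> letter by letter on loops, where word maps are
  continuous. Each operation is followed by \<open>restrict\<close> because members of
  \<open>loops\<close> are undefined off the unit interval.\<close>

fun word_loop :: "'a \<Rightarrow> (nat \<Rightarrow> real \<Rightarrow> 'a::topological_space) \<Rightarrow> word \<Rightarrow> real \<Rightarrow> 'a" where
  "word_loop x g [] = restrict (\<lambda>_. x) {0..1}"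
| "word_loop x g ((i, b) # w) =
    restrict ((if b then g i else restrict (reversepath (g i)) {0..1}) +++ word_loop x g w) {0..1}"

lemma loop_class_word_loop:
  assumes "x \<in> X" "\<forall>i\<in>fst ` set w. g i \<in> loops X x"
  shows "word_loop x g w \<in> loops X x \<and>
    loop_class X x (word_loop x g w) = eval_word (fundamental_group X x) (\<lambda>i. loop_class X x (g i)) w"
  using assms(2)
proof (induction w)
  case Nil
  then show ?case
    by (simp add: const_loop[OF assms(1)] eval_word_def del: restrict_apply)
next
  case (Cons l w)
  obtain i b where l: "l = (i, b)" by force
  show ?case
    using Cons by (cases b)
      (simp_all add: l loop_class_join loop_class_reverse[OF assms(1)] eval_word_def del: restrict_apply)
qed

lemma continuous_map_word_loop:
  assumes "x \<in> X" "fst ` set w \<subseteq> I"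
  shows "continuous_map (product_topology (\<lambda>_. loop_space X x) I) (loop_space X x) (\<lambda>g. word_loop x g w)"
  using assms(2)
proof (induction w)
  case Nil
  then show ?case by (simp add: const_loop[OF assms(1)] del: restrict_apply)
next
  case (Cons l w)
  obtain i b where l: "l = (i, b)" by force
  have "continuous_map (product_topology (\<lambda>_. loop_space X x) I) (loop_space X x) (\<lambda>g. g i)"
    using Cons.prems by (intro continuous_map_product_projection) (auto simp: l)
  then show ?case
    using Cons by (cases b) (auto simp: l simp del: restrict_apply intro!: continuous_map_loop_join continuous_map_loop_reverse)
qed

lemma eval_word_cong:
  assumes "\<And>i. i \<in> fst ` set w \<Longrightarrow> g i = h i"
  shows "eval_word \<Gamma> g w = eval_word \<Gamma> h w"
  using assms by (induction w) (auto simp: eval_word_def)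

locale definable_pi1 = nice_class \<P> + group "fundamental_group X x"
  for \<P> and X :: "'a::metric_space set" and x +
  assumes Polish: "Polish (top_of_set X)" and base: "x \<in> X"
begin

abbreviation "\<pi> \<equiv> fundamental_group X x"

abbreviation "L \<equiv> loop_space X x"

lemmas Polish_L = Polish_loop_space[OF Polish, of x]

text \<open>Covers arbitrary sets of classes, because the values of a word form a subgroup only
  after generation.\<close>

definition definable :: "(real \<Rightarrow> 'a) set set \<Rightarrow> bool" where
  "definable A \<longleftrightarrow> A \<subseteq> carrier \<pi> \<and> in_pointclass \<P> L (\<Union>A)"

lemma pointclass_subgroup_iff: "pointclass_subgroup \<P> X x G \<longleftrightarrow> subgroup G \<pi> \<and> definable G"
  using subgroup.subset by (auto simp: pointclass_subgroup_def definable_def)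

lemma definable_subset: "definable A \<Longrightarrow> A \<subseteq> carrier \<pi>"
  by (simp add: definable_def)

text \<open>The union of these classes is the homotopy saturation of \<open>A\<close>. Hence it
  suffices to find some set of loops in the pointclass that represents the desired classes,
  saturated or not.\<close>

lemma definable_image_loop_class:
  assumes "in_pointclass \<P> L A"
  shows "definable (loop_class X x ` A)"
  using assms in_pointclass_subset[OF assms] homotopy_saturation[OF Polish assms]
  by (auto simp: definable_def homotopy_saturation_def loop_class_carrier)

lemma definable_carrier: "definable (carrier \<pi>)"
proof -
  have "in_pointclass \<P> L (loops X x)"
    using closed[OF Polish_L closedin_topspace] by simp
  from definable_image_loop_class[OF this] show ?thesis
    by (simp add: fundamental_group_def)
qed

text \<open>One representing loop is a closed set of loops, and saturating it gives the whole
  class.\<close>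

lemma definable_singleton:
  assumes "a \<in> carrier \<pi>"
  shows "definable {a}"
proof -
  obtain p where p: "p \<in> loops X x" "a = loop_class X x p"
    using assms by (auto simp: fundamental_group_def)
  then have "closedin L {p}"
    using Polish_imp_Hausdorff[OF Polish_L] by (simp add: closedin_Hausdorff_singleton)
  then show ?thesis
    using definable_image_loop_class[OF closed[OF Polish_L]] p(2) by fastforce
qed

lemma definable_Inter:
  assumes "countable I" "I \<noteq> {}" "\<And>i. i \<in> I \<Longrightarrow> definable (A i)"
  shows "definable (\<Inter>i\<in>I. A i)"
proof -
  have sub: "(\<Inter>i\<in>I. A i) \<subseteq> carrier \<pi>" "\<And>i. i \<in> I \<Longrightarrow> A i \<subseteq> carrier \<pi>"
    using assms(2,3) definable_subset by blast+
  have "\<Union>(\<Inter>i\<in>I. A i) = (\<Inter>i\<in>I. \<Union>(A i))"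
    using assms(2) by (auto simp: Union_classes[OF sub(1)] Union_classes[OF sub(2)])
  then show ?thesis
    using sub Inter_countable[OF Polish_L assms(1,2), of "\<lambda>i. \<Union>(A i)"] assms(3)
    by (simp add: definable_def)
qed

lemma definable_Union_nat:
  assumes "\<And>n::nat. definable (A n)"
  shows "definable (\<Union>n. A n)"
proof -
  have "\<Union>(\<Union>n. A n) = (\<Union>n. \<Union>(A n))" by blast
  moreover have "(\<Union>n. A n) \<subseteq> carrier \<pi>"
    using assms definable_subset by blast
  ultimately show ?thesis
    using Union_nat[OF Polish_L, of "\<lambda>n. \<Union>(A n)"] assms by (simp add: definable_def)
qed

lemma definable_Un: "definable A \<Longrightarrow> definable B \<Longrightarrow> definable (A \<union> B)"
  using Un[OF Polish_L] by (auto simp: definable_def)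

text \<open>The tuples of loops representing elements of the \<open>A i\<close> form a countable
  intersection of preimages under the projections of a finite power of \<open>L\<close>. The word
  map sends these tuples to loops whose classes are exactly the values.\<close>

lemma definable_word_values:
  assumes w: "fst ` set w \<subseteq> {..k}" and A: "\<And>i. i \<le> k \<Longrightarrow> definable (A i)"
  shows "definable {eval_word \<pi> g w | g. \<forall>i\<le>k. g i \<in> A i}"
proof -
  let ?T = "product_topology (\<lambda>_. L) {..k}"
  define B where "B = (\<Inter>i\<in>{..k}. {g \<in> topspace ?T. g i \<in> \<Union>(A i)})"
  have T: "Polish ?T"
    by (intro Polish_product Polish_L) auto
  have "in_pointclass \<P> ?T B"
    unfolding B_def using A
    by (intro Inter_countable preimage[OF T Polish_L] T continuous_map_product_projection)
       (auto simp: definable_def)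
  then have "in_pointclass \<P> L ((\<lambda>g. word_loop x g w) ` B)"
    by (intro image[OF T Polish_L] continuous_map_word_loop base w)
  then have "definable (loop_class X x ` (\<lambda>g. word_loop x g w) ` B)"
    by (rule definable_image_loop_class)
  moreover have "loop_class X x ` (\<lambda>g. word_loop x g w) ` B = {eval_word \<pi> g w | g. \<forall>i\<le>k. g i \<in> A i}"
  proof (intro subset_antisym subsetI)
    fix a assume "a \<in> loop_class X x ` (\<lambda>g. word_loop x g w) ` B"
    then obtain g where g: "g \<in> B" "a = loop_class X x (word_loop x g w)" by blast
    then have "g i \<in> \<Union>(A i)" if "i \<le> k" for i
      using that by (auto simp: B_def)
    then have gi: "g i \<in> loops X x" "loop_class X x (g i) \<in> A i" if "i \<le> k" for i
      using that Union_classes[OF definable_subset[OF A[OF that]]] by auto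
    then have "a = eval_word \<pi> (\<lambda>i. loop_class X x (g i)) w"
      using w loop_class_word_loop[OF base, of w g] unfolding g(2) by blast
    then show "a \<in> {eval_word \<pi> g w | g. \<forall>i\<le>k. g i \<in> A i}"
      using gi(2) by blast
  next
    fix a assume "a \<in> {eval_word \<pi> g w | g. \<forall>i\<le>k. g i \<in> A i}"
    then obtain h where h: "a = eval_word \<pi> h w" "\<And>i. i \<le> k \<Longrightarrow> h i \<in> A i" by blast
    \<comment> \<open>Points of \<open>?T\<close> are undefined outside \<open>{..k}\<close>, hence
      the \<open>restrict\<close>; the choice of representatives is arbitrary.\<close>
    define g where "g = restrict (\<lambda>i. SOME p. p \<in> h i) {..k}"
    have hc: "h i \<in> carrier \<pi>" if "i \<le> k" for i
      using h(2) A definable_subset that by blast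
    have gh: "g i \<in> h i" if "i \<le> k" for i
      using carrier_nonempty[OF hc[OF that]] that by (simp add: g_def some_in_eq)
    have gl: "g i \<in> loops X x" "loop_class X x (g i) = h i" if "i \<le> k" for i
      using carrier_eq_loop_class[OF hc gh] that by auto
    have "g i \<in> \<Union>(A i)" if "i \<le> k" for i
      using gh h(2) that by blast
    moreover have "g \<in> topspace ?T"
      using gl(1) by (auto simp: g_def)
    ultimately have "g \<in> B"
      by (auto simp: B_def)
    moreover have "a = eval_word \<pi> (\<lambda>i. loop_class X x (g i)) w"
      unfolding h(1) using w gl(2) by (intro eval_word_cong) auto
    then have "a = loop_class X x (word_loop x g w)"
      using w gl(1) loop_class_word_loop[OF base, of w g] by auto
    ultimately show "a \<in> loop_class X x ` (\<lambda>g. word_loop x g w) ` B"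
      by blast
  qed
  ultimately show ?thesis by simp
qed

text \<open>Recasts tuples indexed by 0 and 1 as pairs, the form in which products, conjugates and
  commutators are written.\<close>

lemma definable_word_values2:
  assumes w: "fst ` set w \<subseteq> {0, 1}" and A: "definable A" and B: "definable B"
  shows "definable {eval_word \<pi> (\<lambda>i. if i = 0 then a else b) w | a b. a \<in> A \<and> b \<in> B}"
proof -
  let ?C = "\<lambda>i::nat. if i = 0 then A else B"
  have "{eval_word \<pi> (\<lambda>i. if i = 0 then a else b) w | a b. a \<in> A \<and> b \<in> B} =
      {eval_word \<pi> g w | g. \<forall>i\<le>1. g i \<in> ?C i}"
  proof (intro subset_antisym subsetI)
    fix c assume "c \<in> {eval_word \<pi> g w | g. \<forall>i\<le>1. g i \<in> ?C i}"
    then obtain g where g: "c = eval_word \<pi> g w" "\<forall>i\<le>1. g i \<in> ?C i" by blast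
    have "c = eval_word \<pi> (\<lambda>i. if i = 0 then g 0 else g 1) w"
      unfolding g(1) using w by (intro eval_word_cong) auto
    moreover have "g 0 \<in> A" "g 1 \<in> B"
      using g(2) by (auto dest: spec[of _ 1])
    ultimately show "c \<in> {eval_word \<pi> (\<lambda>i. if i = 0 then a else b) w | a b. a \<in> A \<and> b \<in> B}"
      by blast
  next
    fix c assume "c \<in> {eval_word \<pi> (\<lambda>i. if i = 0 then a else b) w | a b. a \<in> A \<and> b \<in> B}"
    then obtain a b where "c = eval_word \<pi> (\<lambda>i. if i = 0 then a else b) w" "a \<in> A" "b \<in> B"
      by blast
    then show "c \<in> {eval_word \<pi> g w | g. \<forall>i\<le>1. g i \<in> ?C i}"
      by (intro CollectI exI[of _ "\<lambda>i. if i = 0 then a else b"]) auto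
  qed
  moreover have "definable {eval_word \<pi> g w | g. \<forall>i\<le>1. g i \<in> ?C i}"
    using w A B by (intro definable_word_values) auto
  ultimately show ?thesis by simp
qed

section \<open>Products, inverses, conjugates and commutators as word values\<close>

lemma definable_mult:
  assumes A: "definable A" and B: "definable B"
  shows "definable {a \<otimes>\<^bsub>\<pi>\<^esub> b | a b. a \<in> A \<and> b \<in> B}"
proof -
  have "eval_word \<pi> (\<lambda>i. if i = 0 then a else b) [(0, True), (1, True)] = a \<otimes>\<^bsub>\<pi>\<^esub> b"
    if "a \<in> A" "b \<in> B" for a b
    using that definable_subset[OF B] by (auto simp: eval_word_def)
  then have "{eval_word \<pi> (\<lambda>i. if i = 0 then a else b) [(0, True), (1, True)] | a b. a \<in> A \<and> b \<in> B} =
      {a \<otimes>\<^bsub>\<pi>\<^esub> b | a b. a \<in> A \<and> b \<in> B}"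
    by blast
  then show ?thesis
    using definable_word_values2[OF _ A B, of "[(0, True), (1, True)]"] by simp
qed

lemma definable_inv:
  assumes A: "definable A"
  shows "definable (m_inv \<pi> ` A)"
proof -
  have "eval_word \<pi> (\<lambda>i. if i = 0 then a else b) [(0, False)] = inv\<^bsub>\<pi>\<^esub> a" if "a \<in> A" for a b
    using that definable_subset[OF A] by (auto simp: eval_word_def)
  \<comment> \<open>The word has a single variable; the idle \<open>b\<close> ranges over
    \<open>A\<close> as well, so it can be taken equal to \<open>a\<close>.\<close>
  then have "{eval_word \<pi> (\<lambda>i. if i = 0 then a else b) [(0, False)] | a b. a \<in> A \<and> b \<in> A} = m_inv \<pi> ` A"
    by blast
  then show ?thesis
    using definable_word_values2[OF _ A A, of "[(0, False)]"] by simp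
qed

lemma definable_conjugates:
  assumes C: "definable C" and A: "definable A"
  shows "definable {c \<otimes>\<^bsub>\<pi>\<^esub> a \<otimes>\<^bsub>\<pi>\<^esub> inv\<^bsub>\<pi>\<^esub> c | c a. c \<in> C \<and> a \<in> A}"
proof -
  let ?w = "[(0, True), (1, True), (0, False)]"
  have "eval_word \<pi> (\<lambda>i. if i = 0 then c else a) ?w = c \<otimes>\<^bsub>\<pi>\<^esub> a \<otimes>\<^bsub>\<pi>\<^esub> inv\<^bsub>\<pi>\<^esub> c"
    if "c \<in> C" "a \<in> A" for c a
    using that definable_subset[OF A] definable_subset[OF C] by (auto simp: eval_word_def m_assoc subset_iff)
  then have "{eval_word \<pi> (\<lambda>i. if i = 0 then c else a) ?w | c a. c \<in> C \<and> a \<in> A} =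
      {c \<otimes>\<^bsub>\<pi>\<^esub> a \<otimes>\<^bsub>\<pi>\<^esub> inv\<^bsub>\<pi>\<^esub> c | c a. c \<in> C \<and> a \<in> A}"
    by blast
  then show ?thesis
    using definable_word_values2[OF _ C A, of ?w] by simp
qed

lemma definable_commutators:
  assumes A: "definable A" and B: "definable B"
  shows "definable {a \<otimes>\<^bsub>\<pi>\<^esub> b \<otimes>\<^bsub>\<pi>\<^esub> inv\<^bsub>\<pi>\<^esub> a \<otimes>\<^bsub>\<pi>\<^esub> inv\<^bsub>\<pi>\<^esub> b | a b. a \<in> A \<and> b \<in> B}"
proof -
  let ?w = "[(0, True), (1, True), (0, False), (1, False)]"
  have "eval_word \<pi> (\<lambda>i. if i = 0 then a else b) ?w = a \<otimes>\<^bsub>\<pi>\<^esub> b \<otimes>\<^bsub>\<pi>\<^esub> inv\<^bsub>\<pi>\<^esub> a \<otimes>\<^bsub>\<pi>\<^esub> inv\<^bsub>\<pi>\<^esub> b"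
    if "a \<in> A" "b \<in> B" for a b
    using that definable_subset[OF A] definable_subset[OF B] by (auto simp: eval_word_def m_assoc subset_iff)
  then have "{eval_word \<pi> (\<lambda>i. if i = 0 then a else b) ?w | a b. a \<in> A \<and> b \<in> B} =
      {a \<otimes>\<^bsub>\<pi>\<^esub> b \<otimes>\<^bsub>\<pi>\<^esub> inv\<^bsub>\<pi>\<^esub> a \<otimes>\<^bsub>\<pi>\<^esub> inv\<^bsub>\<pi>\<^esub> b | a b. a \<in> A \<and> b \<in> B}"
    by blast
  then show ?thesis
    using definable_word_values2[OF _ A B, of ?w] by simp
qed

text \<open>For \<open>A\<close> in the carrier, level \<open>n\<close> consists of the products of
  \<open>2 ^ n\<close> factors from level 0; the identity in level 0 accounts for shorter products.
  Doubling makes each step one application of \<open>definable_mult\<close>.\<close>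

primrec products :: "(real \<Rightarrow> 'a) set set \<Rightarrow> nat \<Rightarrow> (real \<Rightarrow> 'a) set set" where
  "products A 0 = {\<one>\<^bsub>\<pi>\<^esub>} \<union> A \<union> m_inv \<pi> ` A"
| "products A (Suc n) = {a \<otimes>\<^bsub>\<pi>\<^esub> b | a b. a \<in> products A n \<and> b \<in> products A n}"

lemma products_subset_generate: "products A n \<subseteq> generate \<pi> A"
  by (induction n) (auto intro: generate.intros)

lemma generate_eq_Union_products:
  assumes A: "A \<subseteq> carrier \<pi>"
  shows "generate \<pi> A = (\<Union>n. products A n)"
proof
  have carrier: "products A n \<subseteq> carrier \<pi>" for n
    using products_subset_generate generate_incl[OF A] by blast
  have one: "\<one>\<^bsub>\<pi>\<^esub> \<in> products A n" for n
  proof (induction n)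
    case (Suc n)
    then have "\<one>\<^bsub>\<pi>\<^esub> \<otimes>\<^bsub>\<pi>\<^esub> \<one>\<^bsub>\<pi>\<^esub> \<in> products A (Suc n)"
      unfolding products.simps by blast
    then show ?case by simp
  qed simp
  \<comment> \<open>Multiplying by the identity lifts an element one level, so factors from
    different levels can be brought to a common one.\<close>
  have Suc: "products A n \<subseteq> products A (Suc n)" for n
  proof
    fix a assume "a \<in> products A n"
    then have "a \<otimes>\<^bsub>\<pi>\<^esub> \<one>\<^bsub>\<pi>\<^esub> \<in> products A (Suc n)"
      using one[of n] unfolding products.simps by blast
    then show "a \<in> products A (Suc n)"
      using carrier[of n] \<open>a \<in> products A n\<close> by (simp add: subset_iff del: products.simps)
  qed
  have mono: "products A m \<subseteq> products A n" if "m \<le> n" for m n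
    using lift_Suc_mono_le[of "products A", OF Suc that] .
  show "generate \<pi> A \<subseteq> (\<Union>n. products A n)"
  proof
    fix a assume "a \<in> generate \<pi> A"
    then show "a \<in> (\<Union>n. products A n)"
    proof induction
      case (eng h1 h2)
      then obtain m n where "h1 \<in> products A m" "h2 \<in> products A n" by blast
      then have "h1 \<in> products A (max m n)" "h2 \<in> products A (max m n)"
        using mono[of m "max m n"] mono[of n "max m n"] by auto
      then have "h1 \<otimes>\<^bsub>\<pi>\<^esub> h2 \<in> products A (Suc (max m n))"
        by auto
      then show ?case by blast
    qed (auto intro: exI[of _ 0])
  qed
qed (use products_subset_generate in blast)

lemma definable_generate:
  assumes A: "definable A"
  shows "definable (generate \<pi> A)"
proof -
  have "definable (products A n)" for n
  proof (induction n)
    case 0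
    have "definable {\<one>\<^bsub>\<pi>\<^esub>}"
      by (intro definable_singleton) simp
    then show ?case
      using A by (simp add: definable_Un definable_inv del: Un_insert_left)
  qed (simp add: definable_mult)
  then show ?thesis
    unfolding generate_eq_Union_products[OF definable_subset[OF A]] by (rule definable_Union_nat)
qed

lemma pointclass_subgroup_generate: "definable A \<Longrightarrow> pointclass_subgroup \<P> X x (generate \<pi> A)"
  using definable_generate definable_subset generate_is_subgroup
  by (auto simp: pointclass_subgroup_iff)

lemma pointclass_subgroup_commutator:
  "definable A \<Longrightarrow> definable B \<Longrightarrow> pointclass_subgroup \<P> X x (commutator_subgroup \<pi> A B)"
  unfolding commutator_subgroup_def by (intro pointclass_subgroup_generate definable_commutators)

lemma pointclass_subgroup_Inter:
  assumes "countable I" "I \<noteq> {}" "\<And>i. i \<in> I \<Longrightarrow> pointclass_subgroup \<P> X x (G i)"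
  shows "pointclass_subgroup \<P> X x (\<Inter>i\<in>I. G i)"
  using assms definable_Inter[OF assms(1,2), of G] subgroups_Inter[of "G ` I"]
  by (auto simp: pointclass_subgroup_iff)

text \<open>The intersection over all normal subgroups containing \<open>A\<close> may be
  uncountable and so out of reach of a pointclass. The set of conjugates, however, is a set of word
  values with the conjugating variable ranging over the whole group.\<close>

lemma normal_closure_eq_generate:
  assumes A: "A \<subseteq> carrier \<pi>"
  shows "normal_closure \<pi> A =
    generate \<pi> {c \<otimes>\<^bsub>\<pi>\<^esub> a \<otimes>\<^bsub>\<pi>\<^esub> inv\<^bsub>\<pi>\<^esub> c | c a. c \<in> carrier \<pi> \<and> a \<in> A}" (is "_ = generate \<pi> ?C")
proof
  have C: "?C \<subseteq> carrier \<pi>"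
    using A by auto
  \<comment> \<open>Conjugating by \<open>g\<close> a conjugate by \<open>c\<close> is conjugating
    by their product, so a normal subgroup is generated.\<close>
  have "g \<otimes>\<^bsub>\<pi>\<^esub> h \<otimes>\<^bsub>\<pi>\<^esub> inv\<^bsub>\<pi>\<^esub> g \<in> ?C" if h: "h \<in> ?C" and g: "g \<in> carrier \<pi>" for g h
  proof -
    obtain c a where ca: "h = c \<otimes>\<^bsub>\<pi>\<^esub> a \<otimes>\<^bsub>\<pi>\<^esub> inv\<^bsub>\<pi>\<^esub> c" "c \<in> carrier \<pi>" "a \<in> A"
      using h by blast
    have "a \<in> carrier \<pi>" using ca A by blast
    then have "g \<otimes>\<^bsub>\<pi>\<^esub> h \<otimes>\<^bsub>\<pi>\<^esub> inv\<^bsub>\<pi>\<^esub> g = (g \<otimes>\<^bsub>\<pi>\<^esub> c) \<otimes>\<^bsub>\<pi>\<^esub> a \<otimes>\<^bsub>\<pi>\<^esub> inv\<^bsub>\<pi>\<^esub> (g \<otimes>\<^bsub>\<pi>\<^esub> c)"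
      using ca g by (simp add: m_assoc inv_mult_group)
    then show ?thesis
      using ca g by blast
  qed
  then have "generate \<pi> ?C \<lhd> \<pi>"
    using C by (intro normal_generateI)
  moreover have "A \<subseteq> ?C"
  proof
    fix a assume a: "a \<in> A"
    then have "a = \<one>\<^bsub>\<pi>\<^esub> \<otimes>\<^bsub>\<pi>\<^esub> a \<otimes>\<^bsub>\<pi>\<^esub> inv\<^bsub>\<pi>\<^esub> \<one>\<^bsub>\<pi>\<^esub>"
      using A by auto
    then show "a \<in> ?C" using a by blast
  qed
  then have "A \<subseteq> generate \<pi> ?C"
    by (blast intro: generate.incl)
  ultimately show "normal_closure \<pi> A \<subseteq> generate \<pi> ?C"
    unfolding normal_closure_def by blast
  show "generate \<pi> ?C \<subseteq> normal_closure \<pi> A"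
    unfolding normal_closure_def
  proof (rule Inter_greatest)
    fix N assume "N \<in> {N. N \<lhd> \<pi> \<and> A \<subseteq> N}"
    then have N: "N \<lhd> \<pi>" "A \<subseteq> N" by auto
    then have "?C \<subseteq> N"
      using normal.inv_op_closed2 by fastforce
    then show "generate \<pi> ?C \<subseteq> N"
      using N(1) by (intro generate_subgroup_incl normal_imp_subgroup)
  qed
qed

lemma subgroup_conjugate:
  assumes H: "subgroup H \<pi>" and c: "c \<in> carrier \<pi>"
  shows "subgroup (conjugate_set \<pi> c H) \<pi>"
proof -
  let ?\<phi> = "\<lambda>a. c \<otimes>\<^bsub>\<pi>\<^esub> a \<otimes>\<^bsub>\<pi>\<^esub> inv\<^bsub>\<pi>\<^esub> c"
  have "?\<phi> (a \<otimes>\<^bsub>\<pi>\<^esub> b) = ?\<phi> a \<otimes>\<^bsub>\<pi>\<^esub> ?\<phi> b" if "a \<in> carrier \<pi>" "b \<in> carrier \<pi>" for a b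
  proof -
    have "?\<phi> a \<otimes>\<^bsub>\<pi>\<^esub> ?\<phi> b = c \<otimes>\<^bsub>\<pi>\<^esub> a \<otimes>\<^bsub>\<pi>\<^esub> (inv\<^bsub>\<pi>\<^esub> c \<otimes>\<^bsub>\<pi>\<^esub> c) \<otimes>\<^bsub>\<pi>\<^esub> b \<otimes>\<^bsub>\<pi>\<^esub> inv\<^bsub>\<pi>\<^esub> c"
      using that c by (simp only: m_assoc m_closed inv_closed)
    then show ?thesis
      using that c by (simp add: m_assoc)
  qed
  then have "group_hom \<pi> \<pi> ?\<phi>"
    using c by (unfold_locales) (auto simp: hom_def)
  then show ?thesis
    unfolding conjugate_set_def using H by (rule group_hom.subgroup_img_is_subgroup)
qed

text \<open>Transfinite induction along \<open>r\<close>. Countability of the field enters at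
  limits, where the term is an intersection over all predecessors and only countable intersections
  are allowed.\<close>

lemma pointclass_subgroup_derived_series:
  assumes G: "pointclass_subgroup \<P> X x G" and r: "Well_order r" "countable (Field r)"
  shows "pointclass_subgroup \<P> X x (derived_series \<pi> G r \<alpha>)"
proof -
  interpret r: wo_rel r using r(1) by (simp add: wo_rel_def)
  show ?thesis
  proof (induction \<alpha> rule: r.well_order_induct)
    case (1 \<alpha>)
    then have IH: "pointclass_subgroup \<P> X x (derived_series \<pi> G r \<beta>)" if "\<beta> \<in> underS r \<alpha>" for \<beta>
      using that by (auto simp: underS_def)
    consider "underS r \<alpha> = {}" | \<beta> where "is_succ_of r \<alpha> \<beta>"
      | "underS r \<alpha> \<noteq> {}" "\<nexists>\<beta>. is_succ_of r \<alpha> \<beta>" by blast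
    then show ?case
    proof cases
      case 1
      then show ?thesis using G by (simp add: derived_series_zero[OF r(1)])
    next
      case (2 \<beta>)
      then show ?thesis
        using IH[of \<beta>] pointclass_subgroup_commutator
        by (simp add: derived_series_succ[OF r(1) 2] derived_eq_commutator_subgroup is_succ_of_def
            pointclass_subgroup_iff)
    next
      case 3
      have "countable (underS r \<alpha>)"
        using r(2) by (rule countable_subset[rotated]) (auto simp: underS_def Field_def)
      then show ?thesis
        using 3 IH by (simp add: derived_series_limit[OF r(1)] pointclass_subgroup_Inter)
    qed
  qed
qed

end

section \<open>Countable subgroups\<close>

text \<open>Choose one loop from each class in \<open>G\<close>. The homotopies starting at a chosen
  loop end exactly at the loops in the classes of \<open>G\<close>.\<close>

lemma analytic_subgroup_countable:
  assumes X: "Polish (top_of_set X)" "x \<in> X" and G: "subgroup G (fundamental_group X x)" "countable G"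
  shows "analytic_subgroup X x G"
proof -
  let ?\<pi> = "fundamental_group X x" and ?H = "homotopy_space X x" and ?N = "discrete_topology UNIV :: nat topology"
  let ?T = "prod_topology ?H ?N"
  have sub: "G \<subseteq> carrier ?\<pi>" and ne: "G \<noteq> {}"
    using subgroup.subset[OF G(1)] subgroup.one_closed[OF G(1)] by blast+
  then have "from_nat_into G n \<in> carrier ?\<pi>" for n
    using from_nat_into[OF ne] by blast
  then have "\<exists>p\<in>loops X x. loop_class X x p = from_nat_into G n" for n
    by (fastforce simp: fundamental_group_def)
  then obtain p where p: "\<And>n. p n \<in> loops X x" "\<And>n. loop_class X x (p n) = from_nat_into G n"
    by metis
  \<comment> \<open>The set of chosen loops need not be closed in the loop space. Recording the
    index \<open>n\<close> beside the homotopy makes the starting condition an equation between two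
    continuous maps, hence closed.\<close>
  define C where "C = {z \<in> topspace ?T. (slice 0 \<circ> fst) z = (p \<circ> snd) z}"
  have "continuous_map ?T (loop_space X x) (slice 0 \<circ> fst)"
    by (rule continuous_map_compose[OF continuous_map_fst continuous_map_slice]) simp
  moreover have "continuous_map ?T (loop_space X x) (p \<circ> snd)"
    using p(1) by (intro continuous_map_compose[OF continuous_map_snd]) (auto simp: continuous_map_def)
  ultimately have "closedin ?T C"
    unfolding C_def
    by (rule closedin_continuous_maps_eq[OF Polish_imp_Hausdorff[OF Polish_loop_space[OF X(1)]]])
  then have "Polish (subtopology ?T C)"
    by (intro Polish_closedin Polish_prod Polish_homotopy_space X Polish_discrete) auto
  moreover have "continuous_map (subtopology ?T C) (loop_space X x) (slice 1 \<circ> fst)"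
    by (intro continuous_map_from_subtopology continuous_map_compose[OF continuous_map_fst continuous_map_slice]) simp
  ultimately have "analytic_in (loop_space X x) ((slice 1 \<circ> fst) ` topspace (subtopology ?T C))"
    by (rule analytic_inI)
  moreover have "(slice 1 \<circ> fst) ` topspace (subtopology ?T C) = \<Union>G"
  proof -
    have "(slice 1 \<circ> fst) ` topspace (subtopology ?T C) =
        slice 1 ` {h \<in> topspace ?H. slice 0 h \<in> range p}"
    proof (intro subset_antisym subsetI)
      fix q assume "q \<in> slice 1 ` {h \<in> topspace ?H. slice 0 h \<in> range p}"
      then obtain h n where "h \<in> topspace ?H" "slice 0 h = p n" "q = slice 1 h" by blast
      then show "q \<in> (slice 1 \<circ> fst) ` topspace (subtopology ?T C)"
        by (intro image_eqI[of _ _ "(h, n)"]) (auto simp: C_def)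
    qed (auto simp: C_def)
    also have "\<dots> = homotopy_saturation X x (range p)"
      using p(1) by (subst homotopy_saturation_eq_slices) auto
    also have "loop_class X x ` range p = G"
      using range_from_nat_into[OF ne G(2)] by (simp add: image_image p(2))
    then have "homotopy_saturation X x (range p) = \<Union>G"
      by (simp add: homotopy_saturation_def)
    finally show ?thesis .
  qed
  ultimately show ?thesis
    using G(1) by (simp add: analytic_subgroup_def)
qed

lemma analytic_subgroup_carrier:
  assumes "Polish (top_of_set X)" "x \<in> X"
  shows "analytic_subgroup X x (carrier (fundamental_group X x))"
proof -
  interpret group "fundamental_group X x" by (rule group_fundamental_group[OF assms(2)])
  have "\<Union>(carrier (fundamental_group X x)) = topspace (loop_space X x)"
    by (subst Union_classes) (auto simp: loop_class_carrier)
  then show ?thesis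
    using analytic_inI[OF Polish_loop_space[OF assms(1)] continuous_map_id, of x] subgroup_self
    by (simp add: analytic_subgroup_def)
qed


section \<open>Induced homomorphisms\<close>

context
  fixes X :: "'a::metric_space set" and Y :: "'b::metric_space set" and x y f
  assumes f: "continuous_on X f" "f ` X \<subseteq> Y" "f x = y" and x: "x \<in> X"
begin

lemma compose_loop:
  assumes "p \<in> loops X x"
  shows "path (f \<circ> p)" "path_image (f \<circ> p) \<subseteq> Y" "pathstart (f \<circ> p) = y" "pathfinish (f \<circ> p) = y"
proof -
  have p: "path p" "path_image p \<subseteq> X" "pathstart p = x" "pathfinish p = x"
    using assms by (auto simp: loops_def)
  show "path (f \<circ> p)"
    using p f(1) by (intro path_continuous_image) (auto intro: continuous_on_subset)
  show "path_image (f \<circ> p) \<subseteq> Y"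
    using p f(2) by (auto simp: path_image_compose)
  show "pathstart (f \<circ> p) = y" "pathfinish (f \<circ> p) = y"
    using p f(3) by (simp_all add: pathstart_compose pathfinish_compose)
qed

text \<open>The union in \<open>induced_map\<close> collapses to a single class, because
  \<open>f\<close> carries homotopies to homotopies.\<close>

lemma induced_map_loop_class:
  assumes p: "p \<in> loops X x"
  shows "induced_map Y y f (loop_class X x p) = loop_class Y y (restrict (f \<circ> p) {0..1})"
proof -
  have "loop_class Y y (f \<circ> q) = loop_class Y y (f \<circ> p)" if "q \<in> loop_class X x p" for q
    using that f by (intro loop_class_eq[symmetric] homotopic_paths_continuous_image)
      (auto simp: loop_class_def)
  then have "induced_map Y y f (loop_class X x p) = (\<Union>q\<in>loop_class X x p. loop_class Y y (f \<circ> p))"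
    unfolding induced_map_def by (rule SUP_cong[OF refl])
  also have "\<dots> = loop_class Y y (f \<circ> p)"
    using loop_class_self[OF p] by blast
  finally show ?thesis
    by (simp only: loop_class_restrict[OF compose_loop(1,2)[OF p]])
qed

lemma group_hom_induced_map:
  "group_hom (fundamental_group X x) (fundamental_group Y y) (induced_map Y y f)"
proof -
  have "y \<in> Y" using f x by blast
  then interpret Y: group "fundamental_group Y y" by (rule group_fundamental_group)
  interpret X: group "fundamental_group X x" by (rule group_fundamental_group[OF x])
  have rep: "\<exists>p\<in>loops X x. a = loop_class X x p" if "a \<in> carrier (fundamental_group X x)" for a
    using that by (auto simp: fundamental_group_def)
  have ind: "induced_map Y y f (loop_class X x p) = loop_class Y y (f \<circ> p)" if "p \<in> loops X x" for p
    using that compose_loop[OF that]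
    by (simp add: induced_map_loop_class loop_class_restrict del: restrict_apply)
  show ?thesis
  proof (unfold_locales, rule homI)
    fix a assume "a \<in> carrier (fundamental_group X x)"
    then obtain p where p: "p \<in> loops X x" "a = loop_class X x p" using rep by blast
    then show "induced_map Y y f a \<in> carrier (fundamental_group Y y)"
      using compose_loop[OF p(1)] by (simp add: ind loop_class_in_carrier)
  next
    fix a b assume "a \<in> carrier (fundamental_group X x)" "b \<in> carrier (fundamental_group X x)"
    then obtain p q where p: "p \<in> loops X x" "a = loop_class X x p"
      and q: "q \<in> loops X x" "b = loop_class X x q"
      using rep by blast
    note pq = loop_class_join[OF p(1) q(1)]
    have "induced_map Y y f (a \<otimes>\<^bsub>fundamental_group X x\<^esub> b) =
        loop_class Y y (f \<circ> restrict (p +++ q) {0..1})"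
      using pq by (simp add: p q ind flip: pq(2) del: restrict_apply)
    also have "\<dots> = loop_class Y y (restrict (f \<circ> restrict (p +++ q) {0..1}) {0..1})"
      using compose_loop[OF pq(1)] by (simp add: loop_class_restrict del: restrict_apply)
    \<comment> \<open>Composition with \<open>f\<close> respects concatenation exactly and not
      merely up to homotopy.\<close>
    also have "restrict (f \<circ> restrict (p +++ q) {0..1}) {0..1} = restrict ((f \<circ> p) +++ (f \<circ> q)) {0..1}"
      by (auto simp: joinpaths_def)
    also have "loop_class Y y \<dots> = loop_class Y y ((f \<circ> p) +++ (f \<circ> q))"
      using compose_loop[OF p(1)] compose_loop[OF q(1)]
      by (intro loop_class_restrict) (simp_all add: subset_path_image_join)
    also have "\<dots> = induced_map Y y f a \<otimes>\<^bsub>fundamental_group Y y\<^esub> induced_map Y y f b"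
      using compose_loop[OF p(1)] compose_loop[OF q(1)] by (simp add: p q ind loop_class_mult)
    finally show "induced_map Y y f (a \<otimes>\<^bsub>fundamental_group X x\<^esub> b) =
        induced_map Y y f a \<otimes>\<^bsub>fundamental_group Y y\<^esub> induced_map Y y f b" .
  qed
qed

context
  fixes \<P>
  assumes nice: "nice_pointclass \<P>" and X: "Polish (top_of_set X)" and Y: "Polish (top_of_set Y)"
begin

interpretation nice_class \<P>
  by (rule nice_class.intro[OF nice])

interpretation group_hom "fundamental_group X x" "fundamental_group Y y" "induced_map Y y f"
  by (rule group_hom_induced_map)

text \<open>The class of \<open>f \<circ> p\<close> depends only on that of \<open>p\<close>, so the
  loops over the inverse image already form a continuous preimage of the union of \<open>K\<close>,
  without saturation.\<close>

lemma pointclass_subgroup_vimage: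
  assumes K: "pointclass_subgroup \<P> Y y K"
  shows "pointclass_subgroup \<P> X x {a \<in> carrier (fundamental_group X x). induced_map Y y f a \<in> K}"
    (is "pointclass_subgroup _ _ _ ?A")
proof -
  have K': "subgroup K (fundamental_group Y y)" "in_pointclass \<P> (loop_space Y y) (\<Union>K)"
    using K by (auto simp: pointclass_subgroup_def)
  interpret K: subgroup K "fundamental_group Y y" by fact
  have "subgroup ?A (fundamental_group X x)"
    by (rule G.subgroupI) (auto intro: exI[of _ "\<one>\<^bsub>fundamental_group X x\<^esub>"])
  moreover have "\<Union>?A = {p \<in> topspace (loop_space X x). restrict (f \<circ> p) {0..1} \<in> \<Union>K}"
  proof -
    have "restrict (f \<circ> p) {0..1} \<in> loops Y y" if "p \<in> loops X x" for p
      using restrict_loop[OF compose_loop[OF that]] .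
    moreover have A: "?A \<subseteq> carrier (fundamental_group X x)" by blast
    ultimately show ?thesis
      unfolding Union_classes[OF A] Union_classes[OF K.subset] topspace_loop_space
      by (auto simp: induced_map_loop_class loop_class_carrier simp del: restrict_apply)
  qed
  moreover have "in_pointclass \<P> (loop_space X x)
      {p \<in> topspace (loop_space X x). restrict (f \<circ> p) {0..1} \<in> \<Union>K}"
    by (intro preimage[OF Polish_loop_space[OF X, of x] Polish_loop_space[OF Y, of y]]
        continuous_map_loop_compose f K')
  ultimately show ?thesis
    by (simp add: pointclass_subgroup_def)
qed

text \<open>The loops \<open>f \<circ> p\<close> need not exhaust their classes in \<open>Y\<close>,
  so the continuous image has to be saturated there.\<close>

lemma pointclass_subgroup_image:
  assumes K: "pointclass_subgroup \<P> X x K"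
  shows "pointclass_subgroup \<P> Y y (induced_map Y y f ` K)"
proof -
  have K': "subgroup K (fundamental_group X x)" "in_pointclass \<P> (loop_space X x) (\<Union>K)"
    using K by (auto simp: pointclass_subgroup_def)
  have sub: "K \<subseteq> carrier (fundamental_group X x)"
    using subgroup.subset[OF K'(1)] .
  let ?A = "(\<lambda>p. restrict (f \<circ> p) {0..1}) ` \<Union>K"
  have "in_pointclass \<P> (loop_space Y y) ?A"
    by (intro image[OF Polish_loop_space[OF X, of x] Polish_loop_space[OF Y, of y]] continuous_map_loop_compose f K')
  then have "in_pointclass \<P> (loop_space Y y) (homotopy_saturation Y y ?A)"
    by (rule homotopy_saturation[OF Y])
  moreover have "loop_class Y y ` ?A = induced_map Y y f ` loop_class X x ` \<Union>K"
    unfolding image_image using induced_map_loop_class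
    by (intro image_cong) (auto simp: Union_classes[OF sub] simp del: restrict_apply)
  then have "loop_class Y y ` ?A = induced_map Y y f ` K"
    by (simp only: loop_class_image_Union[OF sub])
  then have "homotopy_saturation Y y ?A = \<Union>(induced_map Y y f ` K)"
    by (simp only: homotopy_saturation_def)
  ultimately show ?thesis
    using subgroup_img_is_subgroup[OF K'(1)] by (simp add: pointclass_subgroup_def)
qed

end

end


theorem theorem3p10:
  fixes X :: "'a::metric_space set" and Y :: "'b::metric_space set"
    and x :: 'a and y :: 'b and f :: "'a \<Rightarrow> 'b" and \<P> :: pointclass
  assumes "Polish (top_of_set X)" "path_connected X" "x \<in> X"
    and "Polish (top_of_set Y)" "path_connected Y" "y \<in> Y"
    and "continuous_on X f" "f ` X \<subseteq> Y" "f x = y"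
    and "nice_pointclass \<P>"
  shows
   "(\<forall>H. pointclass_subgroup \<P> Y y H \<longrightarrow>
       pointclass_subgroup \<P> X x {a \<in> carrier (fundamental_group X x). induced_map Y y f a \<in> H}) \<and>
    (\<forall>G. pointclass_subgroup \<P> X x G \<longrightarrow> pointclass_subgroup \<P> Y y (induced_map Y y f ` G)) \<and>
    (analytic_subgroup X x {\<one>\<^bsub>fundamental_group X x\<^esub>} \<and>
     analytic_subgroup X x (carrier (fundamental_group X x))) \<and>
    (\<forall>G :: nat \<Rightarrow> (real \<Rightarrow> 'a) set set. (\<forall>n. pointclass_subgroup \<P> X x (G n)) \<longrightarrow>
       pointclass_subgroup \<P> X x (\<Inter>n. G n) \<and>
       pointclass_subgroup \<P> X x (generate (fundamental_group X x) (\<Union>n. G n))) \<and>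
    (\<forall>G. subgroup G (fundamental_group X x) \<and> countable G \<longrightarrow> analytic_subgroup X x G) \<and>
    (\<forall>G. pointclass_subgroup \<P> X x G \<longrightarrow>
       pointclass_subgroup \<P> X x (normal_closure (fundamental_group X x) G)) \<and>
    (\<forall>G. pointclass_subgroup \<P> X x G \<longrightarrow>
       (\<forall>c \<in> carrier (fundamental_group X x).
          pointclass_subgroup \<P> X x (conjugate_set (fundamental_group X x) c G))) \<and>
    (\<forall>k w (G :: nat \<Rightarrow> (real \<Rightarrow> 'a) set set).
       reduced_word k w \<and> (\<forall>i\<le>k. pointclass_subgroup \<P> X x (G i)) \<longrightarrow>
       pointclass_subgroup \<P> X x
         (generate (fundamental_group X x)
            {eval_word (fundamental_group X x) g w | g. \<forall>i\<le>k. g i \<in> G i})) \<and>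
    (\<forall>G H. pointclass_subgroup \<P> X x G \<and> pointclass_subgroup \<P> X x H \<longrightarrow>
       pointclass_subgroup \<P> X x (commutator_subgroup (fundamental_group X x) G H)) \<and>
    (\<forall>G. pointclass_subgroup \<P> X x G \<longrightarrow>
       (\<forall>(r :: nat rel) \<alpha>. Well_order r \<and> \<alpha> \<in> Field r \<longrightarrow>
          pointclass_subgroup \<P> X x (derived_series (fundamental_group X x) G r \<alpha>)) \<and>
       (\<forall>n. pointclass_subgroup \<P> X x (lower_central (fundamental_group X x) G n)))"

proof -
  have \<P>: "nice_class \<P>"
    using assms(10) by (rule nice_class.intro)
  interpret definable_pi1 \<P> X x
    using \<P> assms(1,3) group_fundamental_group[OF assms(3)]
    by (intro definable_pi1.intro definable_pi1_axioms.intro)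
  have G: "definable G" "subgroup G \<pi>" if "pointclass_subgroup \<P> X x G" for G
    using that by (auto simp: pointclass_subgroup_iff)
  note fs = assms(7-9)
  show ?thesis
  proof (intro conjI allI impI ballI)
    fix H assume "pointclass_subgroup \<P> Y y H"
    then show "pointclass_subgroup \<P> X x {a \<in> carrier \<pi>. induced_map Y y f a \<in> H}"
      by (rule pointclass_subgroup_vimage[OF fs assms(3,10,1,4)])
  next
    fix G assume "pointclass_subgroup \<P> X x G"
    then show "pointclass_subgroup \<P> Y y (induced_map Y y f ` G)"
      by (rule pointclass_subgroup_image[OF fs assms(3,10,1,4)])
  next
    \<comment> \<open>The trivial subgroup is a case of a countable one.\<close>
    show "analytic_subgroup X x {\<one>\<^bsub>\<pi>\<^esub>}"
      using assms(1,3) triv_subgroup by (intro analytic_subgroup_countable) auto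
    show "analytic_subgroup X x (carrier \<pi>)"
      using assms(1,3) by (rule analytic_subgroup_carrier)
  next
    fix G :: "nat \<Rightarrow> (real \<Rightarrow> 'a) set set"
    assume "\<forall>n. pointclass_subgroup \<P> X x (G n)"
    then show "pointclass_subgroup \<P> X x (\<Inter>n. G n)"
      "pointclass_subgroup \<P> X x (generate \<pi> (\<Union>n. G n))"
      using G by (auto intro!: pointclass_subgroup_Inter pointclass_subgroup_generate definable_Union_nat)
  next
    fix G assume "subgroup G \<pi> \<and> countable G"
    then show "analytic_subgroup X x G"
      using assms(1,3) by (intro analytic_subgroup_countable) auto
  next
    fix G assume "pointclass_subgroup \<P> X x G"
    then show "pointclass_subgroup \<P> X x (normal_closure \<pi> G)"
      using G definable_carrier definable_subset
      by (simp add: normal_closure_eq_generate pointclass_subgroup_generate definable_conjugates)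
  next
    fix G c assume "pointclass_subgroup \<P> X x G" and c: "c \<in> carrier \<pi>"
    then have "definable (conjugate_set \<pi> c G)"
      \<comment> \<open>Conjugation by a fixed \<open>c\<close> is the case where the conjugating
        variable ranges over a singleton.\<close>
      using definable_conjugates[OF definable_singleton[OF c] G(1), of G]
      by (simp add: conjugate_set_def image_def Bex_def conj_commute)
    then show "pointclass_subgroup \<P> X x (conjugate_set \<pi> c G)"
      using \<open>pointclass_subgroup \<P> X x G\<close> c by (simp add: pointclass_subgroup_iff subgroup_conjugate)
  next
    fix k w and G :: "nat \<Rightarrow> (real \<Rightarrow> 'a) set set"
    assume "reduced_word k w \<and> (\<forall>i\<le>k. pointclass_subgroup \<P> X x (G i))"
    then show "pointclass_subgroup \<P> X x (generate \<pi> {eval_word \<pi> g w | g. \<forall>i\<le>k. g i \<in> G i})"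
      using G(1) by (intro pointclass_subgroup_generate definable_word_values) (auto simp: reduced_word_def)
  next
    fix G H assume "pointclass_subgroup \<P> X x G \<and> pointclass_subgroup \<P> X x H"
    then show "pointclass_subgroup \<P> X x (commutator_subgroup \<pi> G H)"
      using G(1) by (intro pointclass_subgroup_commutator) auto
  next
    fix G and r :: "nat rel" and \<alpha>
    assume "pointclass_subgroup \<P> X x G" "Well_order r \<and> \<alpha> \<in> Field r"
    then show "pointclass_subgroup \<P> X x (derived_series \<pi> G r \<alpha>)"
      by (intro pointclass_subgroup_derived_series) auto
  next
    fix G n assume H: "pointclass_subgroup \<P> X x G"
    show "pointclass_subgroup \<P> X x (lower_central \<pi> G n)"
      by (induction n) (use H G(1) in \<open>auto intro: pointclass_subgroup_commutator\<close>)
  qed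
qed

end
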